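(* Let $c$ be a Coxeter element of the complex reflection group $G_6$, let $n$ be a positive integer, and let $T$ and $T'$ be two length-$n$ reflection factorizations of $c$. Then $T$ and $T'$ are in the same Hurwitz orbit if and only if they have the same multiset of conjugacy classes (that is, the multiset of $G_6$-conjugacy classes of the entries of $T$ equals that of the entries of $T'$).
   Context: For a finite-dimensional complex vector space $V$, a (generalized) reflection is a linear map $t:V\to V$ with $\dim\ker(t-1)=\dim V-1$; the space $\ker(t-1)$ is its reflecting hyperplane. A complex reflection group is a finite group of linear transformations of $V$ generated by reflections. Let $\zeta=e^{2\pi i/3}$ and $\gamma=e^{2\pi i/12}$. The group $G_6$ is the group of $2\times 2$ complex matrices, acting on $V=\mathbb{C}^2$, generated by $$A=\begin{pmatrix}1&0\\0&\zeta\end{pmatrix},\qquad B=\frac13\begin{pmatrix}\gamma^{11}-\gamma^7&-2\gamma^{11}-\gamma^7\\2\gamma^{11}+4\gamma^7&\gamma^7-\gamma^{11}\end{pmatrix},$$ which satisfy $A^3=I=B^2$ and $ABABAB=BABABA$. An element $g\in G_6$ is $k$-regular if it has order $k$ and has an eigenvector that does not lie in any reflecting hyperplane of a reflection of $G_6$. The Coxeter number $h$ of $G_6$ is the largest integer $h$ such that $G_6$ contains an $h$-regular element, and the Coxeter elements of $G_6$ are its $h$-regular elements. A reflection factorization of $c\in G_6$ of length $n$ is a tuple $(r_1,\dots,r_n)$ of reflections in $G_6$ with $c=r_1r_2\cdots r_n$. For $1\le i\le n-1$, the Hurwitz move $\sigma_i$ is $$\sigma_i(r_1,\dots,r_n)=(r_1,\dots,r_{i-1},\,r_{i+1},\,r_{i+1}^{-1}r_ir_{i+1},\,r_{i+2},\dots,r_n).$$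 The Hurwitz orbit of a factorization is the set of all factorizations that can be reached from it by applying a finite number (possibly zero) of Hurwitz moves. *)

theory Defs
  imports "HOL-Analysis.Analysis" "HOL-Algebra.Multiplicative_Group" "HOL-Algebra.Generated_Groups"
begin

definition GL :: "(complex^'n^'n) monoid" where
  "GL = \<lparr>carrier = {M. invertible M}, mult = (**), one = mat 1\<rparr>"

(* vec.dim is the dimension over the complex numbers, whereas dim would be the real dimension. *)

definition reflecting_hyperplane :: "complex^'n^'n \<Rightarrow> (complex^'n) set" where
  "reflecting_hyperplane t = {v. (t - mat 1) *v v = 0}"

definition is_reflection :: "complex^'n^'n \<Rightarrow> bool" where
  "is_reflection t \<longleftrightarrow>
     vec.dim (reflecting_hyperplane t) = vec.dim (UNIV :: (complex^'n) set) - 1"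

definition reflections :: "(complex^'n^'n) monoid \<Rightarrow> (complex^'n^'n) set" where
  "reflections G = {t \<in> carrier G. is_reflection t}"

definition is_eigenvector :: "complex^'n^'n \<Rightarrow> complex^'n \<Rightarrow> bool" where
  "is_eigenvector g v \<longleftrightarrow> v \<noteq> 0 \<and> (\<exists>\<mu>. g *v v = \<mu> *s v)"

definition is_regular :: "(complex^'n^'n) monoid \<Rightarrow> nat \<Rightarrow> complex^'n^'n \<Rightarrow> bool" where
  "is_regular G k g \<longleftrightarrow>
     g \<in> carrier G \<and> group.ord G g = k \<and>
     (\<exists>v. is_eigenvector g v \<and> (\<forall>t\<in>reflections G. v \<notin> reflecting_hyperplane t))"

definition coxeter_number :: "(complex^'n^'n) monoid \<Rightarrow> nat" where
  "coxeter_number G = (GREATEST h. \<exists>g. is_regular G h g)"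

definition is_coxeter_element :: "(complex^'n^'n) monoid \<Rightarrow> complex^'n^'n \<Rightarrow> bool" where
  "is_coxeter_element G c \<longleftrightarrow> is_regular G (coxeter_number G) c"

definition is_reflection_factorization ::
    "(complex^'n^'n) monoid \<Rightarrow> complex^'n^'n \<Rightarrow> (complex^'n^'n) list \<Rightarrow> bool" where
  "is_reflection_factorization G c T \<longleftrightarrow>
     set T \<subseteq> reflections G \<and> foldr (\<otimes>\<^bsub>G\<^esub>) T \<one>\<^bsub>G\<^esub> = c"

definition conjugacy_class :: "('a, 'b) monoid_scheme \<Rightarrow> 'a \<Rightarrow> 'a set" where
  "conjugacy_class G x = {inv\<^bsub>G\<^esub> h \<otimes>\<^bsub>G\<^esub> x \<otimes>\<^bsub>G\<^esub> h | h. h \<in> carrier G}"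

(* List positions start at 0, so the usual Hurwitz move with index i
   (for i between 1 and n - 1) is hurwitz_move G (i - 1). *)

definition hurwitz_move :: "('a, 'b) monoid_scheme \<Rightarrow> nat \<Rightarrow> 'a list \<Rightarrow> 'a list" where
  "hurwitz_move G i T =
     take i T
     @ [T ! Suc i, inv\<^bsub>G\<^esub> (T ! Suc i) \<otimes>\<^bsub>G\<^esub> T ! i \<otimes>\<^bsub>G\<^esub> T ! Suc i]
     @ drop (i + 2) T"

inductive_set hurwitz_orbit :: "('a, 'b) monoid_scheme \<Rightarrow> 'a list \<Rightarrow> 'a list set"
  for G :: "('a, 'b) monoid_scheme" and T :: "'a list" where
  refl: "T \<in> hurwitz_orbit G T"
| move: "\<lbrakk>U \<in> hurwitz_orbit G T; Suc i < length U\<rbrakk> \<Longrightarrow> hurwitz_move G i U \<in> hurwitz_orbit G T"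

definition \<zeta> :: complex where "\<zeta> = exp (2 * of_real pi * \<i> / 3)"

definition \<gamma> :: complex where "\<gamma> = exp (2 * of_real pi * \<i> / 12)"

definition G6_A :: "complex^2^2" where
  "G6_A = vector [vector [1, 0], vector [0, \<zeta>]]"

definition G6_B :: "complex^2^2" where
  "G6_B = (1 / 3) *\<^sub>R
     vector [vector [\<gamma>^11 - \<gamma>^7, - 2 * \<gamma>^11 - \<gamma>^7],
             vector [2 * \<gamma>^11 + 4 * \<gamma>^7, \<gamma>^7 - \<gamma>^11]]"

definition G6 :: "(complex^2^2) monoid" where
  "G6 = subgroup_generated GL {G6_A, G6_B}"

end

(* A Coxeter element c has order 12, which forces det c = -zeta or det c = -zeta^2. Hence every
   factorization of c has an odd number of reflections of order 2, and the numbers b and d of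
   reflections of determinant zeta and zeta^2 satisfy b + 2d <> 0 (mod 3); in particular it
   contains an involution and a reflection of order 3, which together generate G6.

   A block of product 1, such as (s,s), (u,u^-1) or (u,u,u), can be moved through a factorization by
   Hurwitz moves, and moving it past an entry in the two possible ways conjugates it by that entry.
   As the remaining entries generate G6, the block may be replaced by any conjugate, so equal blocks
   can be split off from two factorizations and one concludes by induction on the length. A block can
   be split off as soon as there are at least three involutions, or b,d > 0, or b > 3, or d > 3; this
   is a finite check on tuples of length 4 or 5. The factorizations that remain have one involution
   and at most two further reflections, all of one class, and are compared directly. *)

theory Submission
  imports Defs
begin

section \<open>Hurwitz moves in a group\<close>

text \<open>The matrices contain \<open>sqrt 3\<close> and complex roots of unity, a form in which
  evaluation cannot compare tuples. Each element therefore gets a normal form with finite data: the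
  scalars \<open>\<i>^k\<close> together with three pairwise anticommuting involutions form a group
  of order 16 satisfying the Pauli relations, \<open>A\<close> permutes the three involutions
  cyclically, and the powers of \<open>A\<close> complete this to 48 elements, 14 of them
  reflections. Classes are traced by determinants: the determinant is a class function, so equal
  class multisets give equal numbers of determinants -1, \<open>\<zeta>\<close> and
  \<open>\<zeta>^2\<close>, and besides the product these three numbers are all that the induction
  compares. Reflections of order 3 are essential even for merging involutions: involutions conjugate
  each other at most by a sign, and only an element of order 3 moves one of the three axes to
  another. Splitting off a block preserves the product, the parity and the congruence, so the
  remainder again contains both kinds of reflections and can conjugate the next block.\<close>

definition conj_by :: "('a, 'b) monoid_scheme \<Rightarrow> 'a \<Rightarrow> 'a \<Rightarrow> 'a" where
  "conj_by G g x = inv\<^bsub>G\<^esub> g \<otimes>\<^bsub>G\<^esub> x \<otimes>\<^bsub>G\<^esub> g"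

abbreviation list_mult :: "('a, 'b) monoid_scheme \<Rightarrow> 'a list \<Rightarrow> 'a" where
  "list_mult G T \<equiv> foldr (\<otimes>\<^bsub>G\<^esub>) T \<one>\<^bsub>G\<^esub>"

lemma hurwitz_move_append:
  assumes "Suc i < length U"
  shows "hurwitz_move G (length xs + i) (xs @ U @ ys) = xs @ hurwitz_move G i U @ ys"
proof -
  have "length xs + i + 2 - length xs = i + 2" by simp
  then show ?thesis
    using assms by (simp add: hurwitz_move_def nth_append)
qed

lemma hurwitz_move_pair:
  "hurwitz_move G (length xs) (xs @ x # y # ys) = xs @ y # conj_by G y x # ys"
  by (simp add: hurwitz_move_def conj_by_def nth_append)

lemma hurwitz_move_cases:
  assumes "Suc i < length U"
  obtains xs x y ys where "U = xs @ x # y # ys" "hurwitz_move G i U = xs @ y # conj_by G y x # ys"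
proof -
  have "U = take i U @ U ! i # U ! Suc i # drop (Suc (Suc i)) U"
    using assms by (metis Cons_nth_drop_Suc Suc_lessD append_take_drop_id)
  then obtain xs x y ys where U: "U = xs @ x # y # ys" "length xs = i"
    by (metis Suc_lessD append_take_drop_id assms length_take min.absorb4)
  then show thesis
    using that hurwitz_move_pair[of G xs x y ys] by simp
qed

lemma hurwitz_orbit_trans:
  assumes "V \<in> hurwitz_orbit G U" "U \<in> hurwitz_orbit G T"
  shows "V \<in> hurwitz_orbit G T"
  using assms by (induction) (auto intro: hurwitz_orbit.move)

lemma hurwitz_orbit_context:
  assumes "U \<in> hurwitz_orbit G T"
  shows "xs @ U @ ys \<in> hurwitz_orbit G (xs @ T @ ys)"
  using assms
proof induction
  case (move U i)
  then have "hurwitz_move G (length xs + i) (xs @ U @ ys) \<in> hurwitz_orbit G (xs @ T @ ys)"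
    by (intro hurwitz_orbit.move) auto
  then show ?case
    using move.hyps by (simp add: hurwitz_move_append)
qed (rule hurwitz_orbit.refl)

lemma hurwitz_orbit_pair: "xs @ y # conj_by G y x # ys \<in> hurwitz_orbit G (xs @ x # y # ys)"
  using hurwitz_orbit.move[OF hurwitz_orbit.refl, of "length xs" "xs @ x # y # ys" G]
  by (simp add: hurwitz_move_pair)

lemma hurwitz_orbit_Cons_append:
  "U \<in> hurwitz_orbit G T \<Longrightarrow> x # U \<in> hurwitz_orbit G (x # T)"
  "U \<in> hurwitz_orbit G T \<Longrightarrow> U @ ys \<in> hurwitz_orbit G (T @ ys)"
  "U \<in> hurwitz_orbit G T \<Longrightarrow> xs @ U \<in> hurwitz_orbit G (xs @ T)"
  using hurwitz_orbit_context[of U G T "[x]" "[]"] hurwitz_orbit_context[of U G T "[]" ys]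
    hurwitz_orbit_context[of U G T xs "[]"] by auto

text \<open>Replaces the positions in \<open>hurwitz_move\<close> by a splitting of the list, so
  that an invariant need only be checked on one pair of neighbours.\<close>

lemma hurwitz_orbit_invariant:
  assumes "U \<in> hurwitz_orbit G T" "P T"
    and "\<And>xs x y ys. P (xs @ x # y # ys) \<Longrightarrow> P (xs @ y # conj_by G y x # ys)"
  shows "P U"
  using assms(1)
proof induction
  case (move U i)
  obtain xs x y ys where "U = xs @ x # y # ys" "hurwitz_move G i U = xs @ y # conj_by G y x # ys"
    using hurwitz_move_cases[OF move.hyps(2)] by blast
  then show ?case
    using assms(3) move.IH by simp
qed (use assms in auto)

lemma hurwitz_orbit_length: "U \<in> hurwitz_orbit G T \<Longrightarrow> length U = length T"
  by (erule hurwitz_orbit_invariant) auto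

section \<open>Products, class functions and sliding of entries in an arbitrary group\<close>

context group
begin

lemma conj_by_closed [simp, intro]:
  "\<lbrakk>g \<in> carrier G; x \<in> carrier G\<rbrakk> \<Longrightarrow> conj_by G g x \<in> carrier G"
  by (simp add: conj_by_def)

lemma conj_by_one [simp]: "x \<in> carrier G \<Longrightarrow> conj_by G \<one> x = x"
  by (simp add: conj_by_def)

lemma conj_by_mult_left:
  "\<lbrakk>g \<in> carrier G; h \<in> carrier G; x \<in> carrier G\<rbrakk> \<Longrightarrow>
    conj_by G (g \<otimes> h) x = conj_by G h (conj_by G g x)"
  by (simp add: conj_by_def m_assoc inv_mult_group)

lemma conj_by_mult:
  assumes "g \<in> carrier G" "x \<in> carrier G" "y \<in> carrier G"
  shows "conj_by G g (x \<otimes> y) = conj_by G g x \<otimes> conj_by G g y"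
  using assms by (simp add: conj_by_def m_assoc) (simp flip: m_assoc)

lemma conj_by_inv:
  "\<lbrakk>g \<in> carrier G; x \<in> carrier G\<rbrakk> \<Longrightarrow> conj_by G g (inv x) = inv (conj_by G g x)"
  by (simp add: conj_by_def m_assoc inv_mult_group)

lemma mult_conj_by: "\<lbrakk>g \<in> carrier G; x \<in> carrier G\<rbrakk> \<Longrightarrow> g \<otimes> conj_by G g x = x \<otimes> g"
  by (simp add: conj_by_def m_assoc) (simp flip: m_assoc)

lemma conj_by_one_right [simp]: "g \<in> carrier G \<Longrightarrow> conj_by G g \<one> = \<one>"
  by (simp add: conj_by_def)

lemma conj_by_self: "p \<in> carrier G \<Longrightarrow> conj_by G p p = p"
  by (simp add: conj_by_def)

lemma conj_by_pow_self: "p \<in> carrier G \<Longrightarrow> conj_by G (p [^] (n :: nat)) p = p"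
  by (induction n) (auto simp: conj_by_mult_left conj_by_self)

lemma list_mult_closed [simp, intro]: "set T \<subseteq> carrier G \<Longrightarrow> list_mult G T \<in> carrier G"
  by (induction T) auto

lemma list_mult_append:
  "\<lbrakk>set T \<subseteq> carrier G; set U \<subseteq> carrier G\<rbrakk> \<Longrightarrow>
    list_mult G (T @ U) = list_mult G T \<otimes> list_mult G U"
  by (induction T) (auto simp: m_assoc)

lemma list_mult_conj_by:
  assumes "g \<in> carrier G" "set T \<subseteq> carrier G"
  shows "list_mult G (map (conj_by G g) T) = conj_by G g (list_mult G T)"
  using assms(2) by (induction T) (auto simp: conj_by_mult assms(1))

lemma hurwitz_orbit_list_mult:
  assumes "U \<in> hurwitz_orbit G T" "set T \<subseteq> carrier G"
  shows "list_mult G U = list_mult G T"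
proof -
  have "set U \<subseteq> carrier G \<and> list_mult G U = list_mult G T"
    using assms(1)
  proof (rule hurwitz_orbit_invariant)
    fix xs x y ys
    assume *: "set (xs @ x # y # ys) \<subseteq> carrier G \<and>
      list_mult G (xs @ x # y # ys) = list_mult G T"
    then have "x \<in> carrier G" "y \<in> carrier G" "set ys \<subseteq> carrier G" "set xs \<subseteq> carrier G"
      by auto
    moreover have "x \<otimes> (y \<otimes> list_mult G ys) = y \<otimes> (conj_by G y x \<otimes> list_mult G ys)"
      using calculation by (simp add: mult_conj_by flip: m_assoc)
    ultimately show "set (xs @ y # conj_by G y x # ys) \<subseteq> carrier G \<and>
      list_mult G (xs @ y # conj_by G y x # ys) = list_mult G T"
      using * by (auto simp: list_mult_append)
  qed (use assms in auto)
  then show ?thesis ..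
qed

text \<open>A move only swaps two entries and conjugates one of them, which a class function cannot
  see. Applied below to \<open>det\<close> and to \<open>conjugacy_class\<close>.\<close>

lemma hurwitz_orbit_image_mset:
  assumes "U \<in> hurwitz_orbit G T" "set T \<subseteq> carrier G"
    and f: "\<And>g x. \<lbrakk>g \<in> carrier G; x \<in> carrier G\<rbrakk> \<Longrightarrow> f (conj_by G g x) = f x"
  shows "image_mset f (mset U) = image_mset f (mset T)"
proof -
  have "set U \<subseteq> carrier G \<and> image_mset f (mset U) = image_mset f (mset T)"
    by (rule hurwitz_orbit_invariant[OF assms(1)])
      (use assms in \<open>auto simp: add_mset_commute\<close>)
  then show ?thesis ..
qed

lemma conjugacy_class_conj_by:
  assumes "g \<in> carrier G" "x \<in> carrier G"
  shows "conjugacy_class G (conj_by G g x) = conjugacy_class G x"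
proof -
  have sub: "conjugacy_class G (conj_by G g x) \<subseteq> conjugacy_class G x"
    if "g \<in> carrier G" "x \<in> carrier G" for g x
  proof
    fix y assume "y \<in> conjugacy_class G (conj_by G g x)"
    then obtain h where "h \<in> carrier G" "y = conj_by G h (conj_by G g x)"
      by (auto simp: conjugacy_class_def conj_by_def)
    then have "g \<otimes> h \<in> carrier G" "y = conj_by G (g \<otimes> h) x"
      using that by (auto simp: conj_by_mult_left)
    then show "y \<in> conjugacy_class G x"
      by (auto simp: conjugacy_class_def conj_by_def)
  qed
  have "conj_by G (inv g) (conj_by G g x) = x"
    using assms by (simp flip: conj_by_mult_left)
  then show ?thesis
    using sub[OF assms] sub[of "inv g" "conj_by G g x"] assms by auto
qed

text \<open>A class function factors through the set of classes; \<open>F\<close> evaluates it at a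
  chosen representative.\<close>

lemma image_mset_eq_of_conjugacy_class:
  assumes "set T \<subseteq> carrier G" "set U \<subseteq> carrier G"
    and f: "\<And>g x. \<lbrakk>g \<in> carrier G; x \<in> carrier G\<rbrakk> \<Longrightarrow> f (conj_by G g x) = f x"
    and eq: "image_mset (conjugacy_class G) (mset T) = image_mset (conjugacy_class G) (mset U)"
  shows "image_mset f (mset T) = image_mset f (mset U)"
proof -
  define F where "F C = f (SOME y. y \<in> C)" for C
  have F: "F (conjugacy_class G x) = f x" if "x \<in> carrier G" for x
  proof -
    have "conj_by G \<one> x \<in> conjugacy_class G x"
      unfolding conjugacy_class_def conj_by_def by blast
    then have "(SOME y. y \<in> conjugacy_class G x) \<in> conjugacy_class G x"
      by (rule someI)
    then obtain g where "g \<in> carrier G" "(SOME y. y \<in> conjugacy_class G x) = conj_by G g x"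
      by (auto simp: conjugacy_class_def conj_by_def)
    then show ?thesis
      using f that by (simp add: F_def)
  qed
  have "image_mset f (mset V) = image_mset F (image_mset (conjugacy_class G) (mset V))"
    if "set V \<subseteq> carrier G" for V
    using that by (auto simp: F image_mset.compositionality intro!: image_mset_cong)
  then show ?thesis
    using assms by simp
qed

text \<open>An entry travelling right past \<open>ys\<close> is conjugated by each entry it passes,
  hence in total by their product, while \<open>ys\<close> stays unchanged. The entries of
  \<open>xs\<close> travel one at a time, the last one first.\<close>

lemma hurwitz_orbit_swap:
  assumes "set xs \<subseteq> carrier G" "set ys \<subseteq> carrier G"
  shows "ys @ map (conj_by G (list_mult G ys)) xs \<in> hurwitz_orbit G (xs @ ys)"
proof -
  have one: "ys @ [conj_by G (list_mult G ys) x] \<in> hurwitz_orbit G (x # ys)"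
    if "x \<in> carrier G" "set ys \<subseteq> carrier G" for x ys
    using that
  proof (induction ys arbitrary: x)
    case Nil
    then show ?case by (simp add: hurwitz_orbit.refl)
  next
    case (Cons y ys)
    have "y # conj_by G y x # ys \<in> hurwitz_orbit G (x # y # ys)"
      using hurwitz_orbit_pair[of "[]"] by simp
    moreover have "ys @ [conj_by G (list_mult G ys) (conj_by G y x)] \<in>
        hurwitz_orbit G (conj_by G y x # ys)"
      using Cons by auto
    then have "y # ys @ [conj_by G (list_mult G (y # ys)) x] \<in> hurwitz_orbit G (y # conj_by G y x # ys)"
      using Cons.prems by (auto simp: conj_by_mult_left intro!: hurwitz_orbit_Cons_append(1))
    ultimately show ?case
      by (auto intro: hurwitz_orbit_trans)
  qed
  show ?thesis
    using assms(1)
  proof (induction xs)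
    case Nil
    then show ?case by (simp add: hurwitz_orbit.refl)
  next
    case (Cons x xs)
    let ?xs = "map (conj_by G (list_mult G ys)) xs"
    have "x # ys @ ?xs \<in> hurwitz_orbit G (x # xs @ ys)"
      using Cons by (auto intro: hurwitz_orbit_Cons_append)
    moreover have "(ys @ [conj_by G (list_mult G ys) x]) @ ?xs \<in> hurwitz_orbit G ((x # ys) @ ?xs)"
      using Cons.prems assms(2) one by (intro hurwitz_orbit_Cons_append) auto
    ultimately show ?case
      by (auto intro: hurwitz_orbit_trans)
  qed
qed

text \<open>The entries of \<open>xs\<close> that pass \<open>z\<close> are conjugated by its
  product, which is 1, so neither list changes.\<close>

lemma hurwitz_orbit_to_front:
  assumes "set xs \<subseteq> carrier G" "set z \<subseteq> carrier G" "list_mult G z = \<one>"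
  shows "z @ xs \<in> hurwitz_orbit G (xs @ z)"
  using hurwitz_orbit_swap[OF assms(1,2)] assms by (simp add: map_idI subset_iff)

text \<open>An entry of the wanted kind moves to the front unchanged; the entries it passes are
  conjugated, which leaves their values under \<open>f\<close> alone, so the selection can be
  repeated on the rest.\<close>

lemma hurwitz_orbit_select:
  assumes "set T \<subseteq> carrier G" "mset cs \<subseteq># image_mset f (mset T)"
    and f: "\<And>g x. \<lbrakk>g \<in> carrier G; x \<in> carrier G\<rbrakk> \<Longrightarrow> f (conj_by G g x) = f x"
  obtains S R where "S @ R \<in> hurwitz_orbit G T" "map f S = cs"
proof -
  have "\<exists>S R. S @ R \<in> hurwitz_orbit G T \<and> map f S = cs"
    using assms(1,2)
  proof (induction cs arbitrary: T)
    case Nil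
    then have "[] @ T \<in> hurwitz_orbit G T"
      by (simp add: hurwitz_orbit.refl)
    then show ?case
      by (metis list.simps(8))
  next
    case (Cons c cs)
    have "c \<in># image_mset f (mset T)"
      using Cons.prems(2) by (metis insert_subset_eq_iff mset.simps(2))
    then obtain x where x: "x \<in> set T" "f x = c"
      by auto
    then obtain as bs where T: "T = as @ x # bs"
      by (meson split_list)
    let ?as = "map (conj_by G x) as"
    have "([x] @ ?as) @ bs \<in> hurwitz_orbit G ((as @ [x]) @ bs)"
      using hurwitz_orbit_swap[of as "[x]"] Cons.prems(1) T
      by (intro hurwitz_orbit_Cons_append) auto
    then have 1: "x # ?as @ bs \<in> hurwitz_orbit G T"
      by (simp add: T)
    have "mset (map f ?as) = mset (map f as)"
      using Cons.prems(1) T f by (intro arg_cong[where f = mset]) auto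
    then have "image_mset f (mset (?as @ bs)) = image_mset f (mset T) - {#c#}"
      using x(2) by (simp add: T image_mset.compositionality)
    moreover have "mset cs \<subseteq># image_mset f (mset T) - {#c#}"
      using Cons.prems(2) by (simp add: insert_subset_eq_iff)
    ultimately obtain S R where "S @ R \<in> hurwitz_orbit G (?as @ bs)" "map f S = cs"
      using Cons.IH[of "?as @ bs"] Cons.prems(1) T by fastforce
    then have "(x # S) @ R \<in> hurwitz_orbit G T" "map f (x # S) = c # cs"
      using 1 x(2) by (auto intro: hurwitz_orbit_trans hurwitz_orbit_Cons_append)
    then show ?case by (intro exI conjI)
  qed
  then show thesis
    using that by blast
qed

end

section \<open>Inverse moves and blocks of product 1 when all elements have finite order\<close>

locale torsion_group = group G for G (structure) +
  assumes torsion: "x \<in> carrier G \<Longrightarrow> \<exists>m>0. x [^] (m :: nat) = \<one>"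
begin

text \<open>Two moves at the same place conjugate the pair by its product, so some power of the move
  is trivial and the move can be undone.\<close>

lemma hurwitz_orbit_pair_reverse:
  assumes "x \<in> carrier G" "y \<in> carrier G"
  shows "[x, y] \<in> hurwitz_orbit G [y, conj_by G y x]"
proof -
  define p where "p = x \<otimes> y"
  have p [simp]: "p \<in> carrier G"
    using assms by (simp add: p_def)
  have pair: "[b, conj_by G b a] \<in> hurwitz_orbit G [a, b]" for a b
    using hurwitz_orbit_pair[of "[]" b G a "[]"] by simp
  have eq: "conj_by G y x = conj_by G p x" "conj_by G (conj_by G y x) y = conj_by G p y"
    using assms by (auto simp: p_def conj_by_mult_left conj_by_def m_assoc inv_mult_group)
      (simp_all flip: m_assoc)
  have 1: "[conj_by G p x, conj_by G p y] \<in> hurwitz_orbit G [y, conj_by G y x]"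
    using pair[where a = y and b = "conj_by G y x"] eq by simp
  \<comment> \<open>Fact \<open>1\<close> already conjugates by \<open>p\<close> once, so index
    \<open>n\<close> stands for the exponent \<open>n + 1\<close>; the cycle closes when
    \<open>p [^] Suc n = \<one>\<close>.\<close>
  have full: "[conj_by G (p [^] n) (conj_by G p x), conj_by G (p [^] n) (conj_by G p y)]
      \<in> hurwitz_orbit G [y, conj_by G y x]" for n :: nat
  proof (induction n)
    case 0
    then show ?case using 1 assms by simp
  next
    case (Suc n)
    define a b where "a = conj_by G (p [^] n) (conj_by G p x)"
      and "b = conj_by G (p [^] n) (conj_by G p y)"
    have ab [simp]: "a \<in> carrier G" "b \<in> carrier G"
      using assms by (auto simp: a_def b_def)
    have "a \<otimes> b = conj_by G (p [^] n) (conj_by G p p)"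
      using assms by (simp add: a_def b_def p_def conj_by_mult)
    also have "\<dots> = p"
      by (simp add: conj_by_self conj_by_pow_self)
    finally have ab_p: "a \<otimes> b = p" .
    have "conj_by G b a = conj_by G p a" "conj_by G (conj_by G b a) b = conj_by G p b"
      unfolding ab_p[symmetric]
      by (auto simp: conj_by_mult_left conj_by_def m_assoc inv_mult_group) (simp_all flip: m_assoc)
    then have "[conj_by G p a, conj_by G p b] \<in> hurwitz_orbit G [a, b]"
      using hurwitz_orbit_trans[OF pair[where a = b and b = "conj_by G b a"] pair[where a = a and b = b]]
      by simp
    moreover have "conj_by G p a = conj_by G (p [^] Suc n) (conj_by G p x)"
      "conj_by G p b = conj_by G (p [^] Suc n) (conj_by G p y)"
      using assms by (simp_all add: a_def b_def conj_by_mult_left)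
    ultimately show ?case
      using Suc by (auto simp: a_def b_def intro: hurwitz_orbit_trans)
  qed
  obtain m :: nat where "m > 0" "p [^] m = \<one>"
    using torsion p by blast
  then obtain n where "p [^] Suc n = \<one>"
    by (metis gr0_conv_Suc)
  then have "conj_by G (p [^] n) (conj_by G p z) = z" if "z \<in> carrier G" for z
    using that conj_by_mult_left[of p "p [^] n" z] nat_pow_Suc2[OF p, of n] by (metis conj_by_one nat_pow_closed p)
  then show ?thesis
    using full[of n] assms by simp
qed

lemma hurwitz_orbit_sym:
  assumes "U \<in> hurwitz_orbit G T" "set T \<subseteq> carrier G"
  shows "T \<in> hurwitz_orbit G U"
proof -
  have "set U \<subseteq> carrier G \<and> T \<in> hurwitz_orbit G U"
    using assms(1)
  proof (rule hurwitz_orbit_invariant)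
    fix xs x y ys
    assume *: "set (xs @ x # y # ys) \<subseteq> carrier G \<and> T \<in> hurwitz_orbit G (xs @ x # y # ys)"
    then have "xs @ [x, y] @ ys \<in> hurwitz_orbit G (xs @ [y, conj_by G y x] @ ys)"
      by (intro hurwitz_orbit_context hurwitz_orbit_pair_reverse) auto
    then show "set (xs @ y # conj_by G y x # ys) \<subseteq> carrier G \<and>
        T \<in> hurwitz_orbit G (xs @ y # conj_by G y x # ys)"
      using * by (auto intro: hurwitz_orbit_trans)
  qed (use assms in \<open>auto intro: hurwitz_orbit.refl\<close>)
  then show ?thesis ..
qed

lemma hurwitz_orbit_conj_block:
  assumes "y \<in> set w" "set w \<subseteq> carrier G" "set z \<subseteq> carrier G" "list_mult G z = \<one>"
  shows "map (conj_by G y) z @ w \<in> hurwitz_orbit G (z @ w)"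
proof -
  obtain as bs where w: "w = as @ y # bs"
    using assms(1) by (meson split_list)
  have y: "y \<in> carrier G" and as: "set as \<subseteq> carrier G"
    using assms(1,2) by (auto simp: w)
  let ?z = "map (conj_by G y) z"
  have z: "set ?z \<subseteq> carrier G" "list_mult G ?z = \<one>"
    using assms y by (auto simp: list_mult_conj_by)
  have "as @ z \<in> hurwitz_orbit G (z @ as)"
    using hurwitz_orbit_sym[OF hurwitz_orbit_to_front[OF as assms(3,4)]] as assms(3) by auto
  then have "(as @ z) @ y # bs \<in> hurwitz_orbit G ((z @ as) @ y # bs)"
    by (rule hurwitz_orbit_Cons_append)
  \<comment> \<open>The block now crosses \<open>y\<close> by moving its own entries, so it is
    conjugated by \<open>y\<close>. On the way to \<open>y\<close> and back to the front it passes
    without change because its product is 1.\<close>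
  moreover have "as @ ([y] @ ?z) @ bs \<in> hurwitz_orbit G (as @ (z @ [y]) @ bs)"
    using y assms hurwitz_orbit_swap[of z "[y]"] by (intro hurwitz_orbit_context) auto
  moreover have "(?z @ as @ [y]) @ bs \<in> hurwitz_orbit G (((as @ [y]) @ ?z) @ bs)"
    using hurwitz_orbit_to_front[of "as @ [y]" ?z] y as z
    by (intro hurwitz_orbit_Cons_append) auto
  ultimately show ?thesis
    by (auto simp: w intro: hurwitz_orbit_trans)
qed

end

section \<open>A combinatorial model of \<open>G\<^sub>6\<close>\<close>

text \<open>Residues modulo 3, in two roles: exponents of \<open>A\<close> and indices of the
  involutions on the one hand, labels of the three reflection classes on the other. As a class label
  \<open>Z0\<close> stands for determinant -1, not 1.\<close>

datatype z3 = Z0 | Z1 | Z2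

fun z3_add :: "z3 \<Rightarrow> z3 \<Rightarrow> z3" where
  "z3_add Z0 y = y"
| "z3_add x Z0 = x"
| "z3_add Z1 Z1 = Z2"
| "z3_add Z1 Z2 = Z0"
| "z3_add Z2 Z1 = Z0"
| "z3_add Z2 Z2 = Z1"

fun z3_neg :: "z3 \<Rightarrow> z3" where
  "z3_neg Z0 = Z0"
| "z3_neg Z1 = Z2"
| "z3_neg Z2 = Z1"

text \<open>The Pauli relations: the involutions square to 1, and two different ones multiply to the
  third up to a factor \<open>\<i>\<close> or \<open>-\<i>\<close>. Multiplied by
  \<open>\<i>\<close> they become quaternion units. The third index is \<open>-(i + j)\<close>
  because the three indices sum to 0 modulo 3.\<close>

fun quat_mult :: "z3 option \<Rightarrow> z3 option \<Rightarrow> bool \<times> bool \<times> z3 option" where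
  "quat_mult None y = (False, False, y)"
| "quat_mult x None = (False, False, x)"
| "quat_mult (Some i) (Some j) = (if i = j then (False, False, None)
     else (i = z3_add j Z2, True, Some (z3_neg (z3_add i j))))"

fun quat_shift :: "z3 \<Rightarrow> z3 option \<Rightarrow> z3 option" where
  "quat_shift l None = None"
| "quat_shift l (Some j) = Some (z3_add j (z3_neg l))"

text \<open>The code \<open>(s, t, w, l)\<close> stands for \<open>(-1)^s * \<i>^t * Q w * A^l\<close>, where \<open>Q None = 1\<close> and the
  three \<open>Q (Some j)\<close> are the conjugates of \<open>B\<close> under \<open>A\<close>. The equation
  \<open>quat_mult w x = (s, t, y)\<close> means \<open>Q w * Q x = (-1)^s * \<i>^t * Q y\<close>, and
  \<open>A^l * Q w = Q (quat_shift l w) * A^l\<close>.\<close>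

type_synonym code = "bool \<times> bool \<times> z3 option \<times> z3"

abbreviation code_one :: code where "code_one \<equiv> (False, False, None, Z0)"

text \<open>Inequality of truth values is addition of exponents modulo 2. The terms
  \<open>t \<and> t'\<close> and \<open>(t \<noteq> t') \<and> t''\<close> are the carries from
  \<open>\<i> * \<i> = -1\<close>.\<close>

fun code_mult :: "code \<Rightarrow> code \<Rightarrow> code" where
  "code_mult (s, t, w, l) (s', t', w', l') =
    (case quat_mult w (quat_shift l w') of (s'', t'', x) \<Rightarrow>
      ((s \<noteq> s') \<noteq> ((s'' \<noteq> (t \<and> t')) \<noteq> ((t \<noteq> t') \<and> t'')), (t \<noteq> t') \<noteq> t'', x, z3_add l l'))"

text \<open>The factors are inverted in reverse order. \<open>Q w\<close> is its own inverse, and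
  the sign \<open>s \<noteq> t\<close> comes from the inverse of \<open>\<i>\<close> being
  \<open>-\<i>\<close>.\<close>

fun code_inv :: "code \<Rightarrow> code" where
  "code_inv (s, t, w, l) = code_mult (False, False, None, z3_neg l) (s \<noteq> t, t, w, Z0)"

fun code_pow :: "nat \<Rightarrow> code \<Rightarrow> code" where
  "code_pow 0 g = code_one"
| "code_pow (Suc n) g = code_mult g (code_pow n g)"

definition code_conj :: "code \<Rightarrow> code \<Rightarrow> code" where
  "code_conj g x = code_mult (code_inv g) (code_mult x g)"

definition all_codes :: "code list" where
  "all_codes = List.product [False, True] (List.product [False, True]
     (List.product [None, Some Z0, Some Z1, Some Z2] [Z0, Z1, Z2]))"

text \<open>The reflections of determinant \<open>-1\<close>, \<open>\<zeta>\<close> and \<open>\<zeta>\<^sup>2\<close>, which are the three conjugacy classes.\<close>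

fun refl_codes :: "z3 \<Rightarrow> code list" where
  "refl_codes Z0 = [(False, False, Some Z0, Z0), (False, False, Some Z1, Z0), (False, False, Some Z2, Z0),
     (True, False, Some Z0, Z0), (True, False, Some Z1, Z0), (True, False, Some Z2, Z0)]"
| "refl_codes Z1 = [(False, False, None, Z1), (False, True, Some Z0, Z1), (False, True, Some Z1, Z1),
     (False, True, Some Z2, Z1)]"
| "refl_codes Z2 = [(False, False, None, Z2), (True, True, Some Z0, Z2), (True, True, Some Z1, Z2),
     (True, True, Some Z2, Z2)]"

fun code_move :: "nat \<Rightarrow> code list \<Rightarrow> code list" where
  "code_move 0 (x # y # r) = y # code_conj y x # r"
| "code_move (Suc i) (x # r) = x # code_move i r"
| "code_move i r = r"

text \<open>A path is a list of move positions, applied from left to right. Testing a few given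
  paths avoids enumerating whole orbits.\<close>

fun search :: "(code list \<Rightarrow> bool) \<Rightarrow> nat list list \<Rightarrow> code list \<Rightarrow> bool" where
  "search P [] S = False"
| "search P (p # ps) S = (if P (fold code_move p S) then True else search P ps S)"

fun code_prefix :: "code list \<Rightarrow> code list \<Rightarrow> bool" where
  "code_prefix [] ys = True"
| "code_prefix (x # xs) [] = False"
| "code_prefix (x # xs) (y # ys) = (if x = y then code_prefix xs ys else False)"

text \<open>Every block in use begins with the entry that parametrizes it, so the only candidate at
  a position is \<open>g x\<close> for the entry \<open>x\<close> found there.\<close>

fun has_block :: "(code \<Rightarrow> code list) \<Rightarrow> z3 \<Rightarrow> code list \<Rightarrow> bool" where
  "has_block g m [] = False"
| "has_block g m (x # xs) =
    ((x \<in> set (refl_codes m) \<and> code_prefix (g x) (x # xs)) \<or> has_block g m xs)"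

definition square_block :: "code \<Rightarrow> code list" where "square_block x = [x, x]"
definition pair_block :: "code \<Rightarrow> code list" where "pair_block x = [x, code_inv x]"
definition cube_block :: "code \<Rightarrow> code list" where "cube_block x = [x, x, x]"

fun doubled_right :: "z3 \<Rightarrow> code list \<Rightarrow> bool" where
  "doubled_right m [e, x, y] = (x = y \<and> x \<in> set (refl_codes m) \<and> e \<in> set (refl_codes Z0))"
| "doubled_right m _ = False"

fun doubled_left :: "z3 \<Rightarrow> code list \<Rightarrow> bool" where
  "doubled_left m [x, y, e] = (x = y \<and> x \<in> set (refl_codes m) \<and> e \<in> set (refl_codes Z0))"
| "doubled_left m _ = False"

text \<open>The paths \<open>[0, 0]\<close> and \<open>[0, 1, 0, 1, 0, 1]\<close> are the full twists on two and three strands: they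
  conjugate every entry by the product. In the second check the pair \<open>[u, u]\<close> plays the role of the
  single reflection \<open>inverse u\<close>.\<close>

fun twists_to2 :: "code list \<Rightarrow> bool" where
  "twists_to2 [e, u, e', u'] = (if code_mult e u = code_mult e' u' then
     search (code_prefix [e', u']) [[], [0, 0], [0, 0, 0, 0]] [e, u] else True)"
| "twists_to2 _ = True"

fun twists_to3 :: "code list \<Rightarrow> bool" where
  "twists_to3 [e, u, e', u'] =
     (if code_mult e (code_mult u u) = code_mult e' (code_mult u' u') then
       search (code_prefix [e', u', u']) [[], [0, 1, 0, 1, 0, 1], [0, 1, 0, 1, 0, 1, 0, 1, 0, 1, 0, 1]] [e, u, u] else True)"
| "twists_to3 _ = True"

fun spread :: "nat \<Rightarrow> code \<Rightarrow> code \<Rightarrow> code list \<Rightarrow> code list" where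
  "spread 0 e u xs = xs"
| "spread (Suc n) e u xs = spread n e u (remdups (xs @ map (code_conj e) xs @ map (code_conj u) xs))"

fun spreads :: "z3 \<Rightarrow> code list \<Rightarrow> bool" where
  "spreads m [e, u] = list_all (\<lambda>x. x \<in> set (spread 4 e u [hd (refl_codes m)])) (refl_codes m)"
| "spreads m _ = True"

definition conj_stable :: "z3 \<Rightarrow> code list \<Rightarrow> bool" where
  "conj_stable m S = (code_conj (S ! 0) (S ! 1) \<in> set (refl_codes m))"

text \<open>In the last clause the condition fails exactly for the elements of determinant
  \<open>-\<zeta>\<close> or \<open>-\<zeta>^2\<close>; all others have order dividing 4 or 6, so no
  other element can have order 12.\<close>

fun order_facts :: "code \<Rightarrow> bool" where
  "order_facts (s, t, w, l) =
    (code_mult (code_inv (s, t, w, l)) (s, t, w, l) = code_one \<and>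
     code_pow 12 (s, t, w, l) = code_one \<and>
     (if l = Z0 \<or> t = (w \<noteq> None) then code_pow 4 (s, t, w, l) = code_one \<or> code_pow 6 (s, t, w, l) = code_one
      else True))"

section \<open>Finite checks on codes\<close>

lemma all_order_facts: "list_all order_facts all_codes"
  by code_simp

lemma all_conj_stable:
  "list_all (conj_stable Z0) (product_lists [concat (map refl_codes [Z0, Z1, Z2]), refl_codes Z0])"
  "list_all (conj_stable Z1) (product_lists [concat (map refl_codes [Z0, Z1, Z2]), refl_codes Z1])"
  "list_all (conj_stable Z2) (product_lists [concat (map refl_codes [Z0, Z1, Z2]), refl_codes Z2])"
  by code_simp+

text \<open>Generation in the form needed for blocks: words of length at most 4 in one involution
  and one reflection of order 3 conjugate the first element of each class to all the others.\<close>

lemma all_spreads: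
  "list_all (spreads Z0) (product_lists [refl_codes Z0, refl_codes Z1 @ refl_codes Z2])"
  "list_all (spreads Z1) (product_lists [refl_codes Z0, refl_codes Z1 @ refl_codes Z2])"
  "list_all (spreads Z2) (product_lists [refl_codes Z0, refl_codes Z1 @ refl_codes Z2])"
  by code_simp+

text \<open>Powers 0, 1 and 2 of the full twist exhaust its action. Modulo the four scalars the
  group has order 12, and a product involving a nontrivial power of \<open>A\<close> has order 3
  there, so conjugating by it three times is trivial. The same holds for three strands.\<close>

lemma all_twists_to2:
  "list_all twists_to2 (product_lists [refl_codes Z0, refl_codes Z1, refl_codes Z0, refl_codes Z1])"
  "list_all twists_to2 (product_lists [refl_codes Z0, refl_codes Z2, refl_codes Z0, refl_codes Z2])"
  by code_simp+

lemma all_twists_to3: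
  "list_all twists_to3 (product_lists [refl_codes Z0, refl_codes Z1, refl_codes Z0, refl_codes Z1])"
  "list_all twists_to3 (product_lists [refl_codes Z0, refl_codes Z2, refl_codes Z0, refl_codes Z2])"
  by code_simp+

text \<open>The lists of paths below were found by a computer search.\<close>

definition double_paths :: "nat list list" where
  "double_paths = [[], [0, 0], [1, 0, 0], [1, 1, 0, 0]]"

lemma all_doubled_right:
  "list_all (search (doubled_right Z1) double_paths) (product_lists [refl_codes Z0, refl_codes Z1, refl_codes Z1])"
  "list_all (search (doubled_right Z2) double_paths) (product_lists [refl_codes Z0, refl_codes Z2, refl_codes Z2])"
  by code_simp+

text \<open>After \<open>[e, x, x]\<close> has been reached, the moves 0 and 1 carry the involution
  right past both copies of \<open>x\<close>, which stay unchanged.\<close>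

lemma all_doubled_left:
  "list_all (search (doubled_left Z1) (map (\<lambda>p. p @ [0, 1]) double_paths))
    (product_lists [refl_codes Z0, refl_codes Z1, refl_codes Z1])"
  "list_all (search (doubled_left Z2) (map (\<lambda>p. p @ [0, 1]) double_paths))
    (product_lists [refl_codes Z0, refl_codes Z2, refl_codes Z2])"
  by code_simp+

definition square_paths :: "nat list list" where
  "square_paths = [[], [0, 0, 1], [1, 1, 0], [2, 2, 1], [0, 0, 2, 2, 1]]"

text \<open>Three involutions with different indices can never be made equal among themselves, since
  they conjugate each other only by signs. The reflection of order 3 permutes the indices and makes
  a square reachable.\<close>

lemma all_square:
  "list_all (search (has_block square_block Z0) square_paths)
    (product_lists [refl_codes Z0, refl_codes Z0, refl_codes Z0, refl_codes Z1])"
  "list_all (search (has_block square_block Z0) square_paths)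
    (product_lists [refl_codes Z0, refl_codes Z0, refl_codes Z0, refl_codes Z2])"
  by code_simp+

definition pair_paths :: "nat list list" where
  "pair_paths = [[2], [0, 1, 1, 0, 2], [0, 0, 2, 1, 1], [2, 1, 0, 0, 1], [1, 2], [1, 0, 2, 1, 1]]"

lemma all_pair:
  "list_all (search (has_block pair_block Z1) pair_paths)
    (product_lists [refl_codes Z0, refl_codes Z1, refl_codes Z1, refl_codes Z2])"
  "list_all (search (has_block pair_block Z1) pair_paths)
    (product_lists [refl_codes Z0, refl_codes Z2, refl_codes Z2, refl_codes Z1])"
  by code_simp+

text \<open>Doubling the reflections on both sides of the involution beforehand leaves three
  parameters, so 96 tuples are searched instead of \<open>6 * 4^4\<close>.\<close>

fun cube_search :: "z3 \<Rightarrow> code list \<Rightarrow> bool" where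
  "cube_search m [x, e, y] =
    search (has_block cube_block m) [[1], [2], [1, 1, 1], [2, 2, 2]] [x, x, e, y, y]"
| "cube_search m _ = True"

lemma all_cube:
  "list_all (cube_search Z1) (product_lists [refl_codes Z1, refl_codes Z0, refl_codes Z1])"
  "list_all (cube_search Z2) (product_lists [refl_codes Z2, refl_codes Z0, refl_codes Z2])"
  by code_simp+

section \<open>The matrices of \<open>G\<^sub>6\<close>\<close>

abbreviation r3 :: complex where "r3 \<equiv> complex_of_real (sqrt 3)"

lemma zeta_Complex: "\<zeta> = Complex (- 1 / 2) (sqrt 3 / 2)"
proof -
  have "\<zeta> = cis (2 * pi / 3)"
    by (simp add: \<zeta>_def cis_conv_exp mult.commute)
  then show ?thesis
    using sin_120' by (simp add: complex_eq_iff cos_120' mult.commute)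
qed

lemma gamma_Complex: "\<gamma> = Complex (sqrt 3 / 2) (1 / 2)"
proof -
  have "\<gamma> = cis (pi / 6)"
    by (simp add: \<gamma>_def cis_conv_exp mult.commute)
  then show ?thesis
    by (simp add: complex_eq_iff cos_30 sin_30)
qed

text \<open>Writing \<open>\<zeta>^2\<close> as \<open>- 1 - \<zeta>\<close> keeps expressions
  linear in \<open>\<zeta>\<close> when they are simplified with \<open>zeta_square\<close>.\<close>

fun zeta_pow :: "z3 \<Rightarrow> complex" where
  "zeta_pow Z0 = 1"
| "zeta_pow Z1 = \<zeta>"
| "zeta_pow Z2 = - 1 - \<zeta>"

definition unit_of :: "bool \<Rightarrow> bool \<Rightarrow> complex" where
  "unit_of s t = (if s then - 1 else 1) * (if t then \<i> else 1)"

definition mk :: "complex \<Rightarrow> complex \<Rightarrow> complex \<Rightarrow> complex \<Rightarrow> complex^2^2" where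
  "mk a b c d = vector [vector [a, b], vector [c, d]]"

text \<open>The involution \<open>Some j\<close> is \<open>A ** M ** inverse A\<close> for the involution \<open>M\<close> at \<open>j + 1\<close>;
  the generator \<open>B\<close> is the one at \<open>Z1\<close>.\<close>

fun quat_mat :: "z3 option \<Rightarrow> complex^2^2" where
  "quat_mat None = mk 1 0 0 1"
| "quat_mat (Some j) = mk (r3 / 3) (zeta_pow j * r3 / 3) (2 * zeta_pow (z3_neg j) * r3 / 3) (- r3 / 3)"

definition rot_mat :: "z3 \<Rightarrow> complex^2^2" where
  "rot_mat l = mk 1 0 0 (zeta_pow l)"

definition scal_mat :: "complex \<Rightarrow> complex^2^2" where
  "scal_mat c = mk c 0 0 c"

fun mat_of :: "code \<Rightarrow> complex^2^2" where
  "mat_of (s, t, w, l) = scal_mat (unit_of s t) ** (quat_mat w ** rot_mat l)"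

lemma mk_eq_iff [simp]: "mk a b c d = mk a' b' c' d' \<longleftrightarrow> a = a' \<and> b = b' \<and> c = c' \<and> d = d'"
  by (auto simp: mk_def vec_eq_iff forall_2)

lemma mk_mult [simp]:
  "mk a b c d ** mk a' b' c' d' = mk (a * a' + b * c') (a * b' + b * d') (c * a' + d * c') (c * b' + d * d')"
  by (simp add: mk_def vec_eq_iff forall_2 matrix_matrix_mult_def sum_2)

lemma mk_diff [simp]: "mk a b c d - mk a' b' c' d' = mk (a - a') (b - b') (c - c') (d - d')"
  by (simp add: mk_def vec_eq_iff forall_2)

lemma det_mk [simp]: "det (mk a b c d) = a * d - b * c"
  by (simp add: mk_def det_2)

lemma mat_1_mk: "mat 1 = mk 1 0 0 1"
  by (simp add: mk_def mat_def vec_eq_iff forall_2)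

lemma r3_square: "r3 * r3 = 3" "r3 * (r3 * x) = 3 * x"
proof -
  show "r3 * r3 = 3"
    by (metis of_real_mult of_real_numeral real_sqrt_mult_self abs_numeral)
  then show "r3 * (r3 * x) = 3 * x"
    by (simp flip: mult.assoc)
qed

lemma zeta_square: "\<zeta> * \<zeta> = - 1 - \<zeta>" "\<zeta> * (\<zeta> * x) = (- 1 - \<zeta>) * x"
proof -
  show "\<zeta> * \<zeta> = - 1 - \<zeta>"
    by (simp add: zeta_Complex complex_eq_iff)
  then show "\<zeta> * (\<zeta> * x) = (- 1 - \<zeta>) * x"
    by (simp flip: mult.assoc)
qed

lemma G6_A_eq: "G6_A = mat_of (False, False, None, Z1)"
  by (simp add: G6_A_def rot_mat_def scal_mat_def unit_of_def flip: mk_def)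

lemma G6_B_eq: "G6_B = mat_of (False, False, Some Z1, Z0)"
proof -
  have g2: "\<gamma> ^ 2 = 1 + \<zeta>"
    by (simp add: power2_eq_square gamma_Complex zeta_Complex complex_eq_iff)
  have "\<gamma> * (1 + \<zeta>) = \<i>"
    by (simp add: gamma_Complex zeta_Complex complex_eq_iff algebra_simps)
  then have g3: "\<gamma> ^ 3 = \<i>"
    using g2 by (simp add: eval_nat_numeral)
  \<comment> \<open>Since \<open>\<gamma>^3 = \<i>\<close>, the exponents are split as 7 = 2*3 + 1
    and 11 = 3*3 + 2.\<close>
  have "\<gamma> ^ 7 = (\<gamma> ^ 3) ^ 2 * \<gamma>" "\<gamma> ^ 11 = (\<gamma> ^ 3) ^ 3 * \<gamma> ^ 2"
    by (simp_all flip: power_mult power_add power_Suc2)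
  then have g: "\<gamma> ^ 7 = Complex (- sqrt 3 / 2) (- 1 / 2)" "\<gamma> ^ 11 = Complex (sqrt 3 / 2) (- 1 / 2)"
    unfolding g2 g3 by (simp_all add: gamma_Complex zeta_Complex complex_eq_iff eval_nat_numeral)
  have third: "(1 / 3) *\<^sub>R a = a / 3" for a :: complex
    by (simp add: scaleR_conv_of_real)
  have "(1 / 3) *\<^sub>R mk a b c d = mk (a / 3) (b / 3) (c / 3) (d / 3)" for a b c d
    using third by (simp add: mk_def vec_eq_iff forall_2)
  then show ?thesis
    unfolding G6_B_def g mk_def[symmetric]
    by (simp add: rot_mat_def scal_mat_def unit_of_def)
      (simp add: zeta_Complex complex_eq_iff algebra_simps)
qed

lemma zeta_pow_add: "zeta_pow (z3_add l l') = zeta_pow l * zeta_pow l'"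
  by (cases l; cases l') (simp_all add: zeta_square algebra_simps)

lemma rot_mat_add: "rot_mat (z3_add l l') = rot_mat l ** rot_mat l'"
  by (simp add: rot_mat_def zeta_pow_add)

lemma rot_quat_mat: "rot_mat l ** quat_mat w = quat_mat (quat_shift l w) ** rot_mat l"
proof (cases w)
  case None
  then show ?thesis by (simp add: rot_mat_def)
next
  case (Some j)
  then show ?thesis
    by (cases l; cases j) (simp_all add: rot_mat_def zeta_square algebra_simps)
qed

lemma quat_mat_mult:
  assumes "quat_mult w x = (s, t, y)"
  shows "quat_mat w ** quat_mat x = scal_mat (unit_of s t) ** quat_mat y"
proof (cases "w = None \<or> x = None")
  case True
  then show ?thesis
    using assms by (cases w; cases x) (auto simp: unit_of_def scal_mat_def)
next
  case False
  obtain a b where "w = Some a" "x = Some b"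
    using False by auto
  then show ?thesis
    using assms by (cases a; cases b)
      (auto simp: unit_of_def scal_mat_def zeta_Complex complex_eq_iff field_simps)
qed

lemma scal_mat_commute: "scal_mat c ** M = M ** scal_mat c"
  by (simp add: scal_mat_def mk_def vec_eq_iff forall_2 matrix_matrix_mult_def sum_2)

lemma scal_mat_mult: "scal_mat c ** scal_mat d = scal_mat (c * d)"
  by (simp add: scal_mat_def)

text \<open>Scalars are central and a power of \<open>A\<close> crosses an involution by shifting
  its index, so the product of two normal forms can be sorted back into normal form.\<close>

lemma mat_of_mult: "mat_of (code_mult x y) = mat_of x ** mat_of y"
proof -
  obtain s t w l s' t' w' l' where x: "x = (s, t, w, l)" and y: "y = (s', t', w', l')"
    by (metis prod_cases4)
  obtain s'' t'' v where q: "quat_mult w (quat_shift l w') = (s'', t'', v)"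
    by (metis prod_cases3)
  define u u' u'' where "u = scal_mat (unit_of s t)" and "u' = scal_mat (unit_of s' t')"
    and "u'' = scal_mat (unit_of s'' t'')"
  have comm: "quat_mat w ** u' = u' ** quat_mat w"
    by (simp add: u'_def scal_mat_commute)
  have "mat_of x ** mat_of y = u ** (quat_mat w ** (rot_mat l ** u' ** quat_mat w' ** rot_mat l'))"
    by (simp add: x y u_def u'_def matrix_mul_assoc)
  also have "rot_mat l ** u' = u' ** rot_mat l"
    by (simp add: u'_def scal_mat_commute)
  also have "u ** (quat_mat w ** (u' ** rot_mat l ** quat_mat w' ** rot_mat l')) =
      u ** (quat_mat w ** u') ** (rot_mat l ** quat_mat w') ** rot_mat l'"
    by (simp add: matrix_mul_assoc)
  also have "\<dots> = u ** u' ** (quat_mat w ** quat_mat (quat_shift l w')) ** (rot_mat l ** rot_mat l')"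
    by (simp only: comm rot_quat_mat matrix_mul_assoc)
  also have "\<dots> = (u ** u' ** u'') ** (quat_mat v ** rot_mat (z3_add l l'))"
    by (simp add: quat_mat_mult[OF q] u''_def rot_mat_add matrix_mul_assoc)
  also have "u ** u' ** u'' =
      scal_mat (unit_of ((s \<noteq> s') \<noteq> ((s'' \<noteq> (t \<and> t')) \<noteq> ((t \<noteq> t') \<and> t''))) ((t \<noteq> t') \<noteq> t''))"
    unfolding u_def u'_def u''_def scal_mat_mult
    by (rule arg_cong[where f = scal_mat]) (auto simp: unit_of_def)
  finally show ?thesis
    by (simp add: x y q)
qed

lemma mat_of_one: "mat_of code_one = mat 1"
  by (simp add: mat_1_mk rot_mat_def scal_mat_def unit_of_def)

lemma in_all_codes: "x \<in> set all_codes"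
proof -
  obtain s t w l where x: "x = (s, t, w, l)"
    by (metis prod_cases4)
  show ?thesis
    by (cases s; cases t; cases w; cases l; cases "the w") (auto simp: x all_codes_def)
qed

lemma code_inv_mult: "code_mult (code_inv x) x = code_one"
  using all_order_facts in_all_codes[of x] by (cases x) (auto simp: list_all_iff)

lemma mat_of_inv: "mat_of (code_inv x) ** mat_of x = mat 1"
  by (metis code_inv_mult mat_of_mult mat_of_one)

lemma mat_of_entries:
  "mat_of (s, t, None, l) = mk (unit_of s t) 0 0 (unit_of s t * zeta_pow l)"
  "mat_of (s, t, Some j, l) = mk (unit_of s t * (r3 / 3)) (unit_of s t * (zeta_pow j * r3 / 3 * zeta_pow l))
     (unit_of s t * (2 * zeta_pow (z3_neg j) * r3 / 3)) (unit_of s t * (- r3 / 3 * zeta_pow l))"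
  by (simp_all add: scal_mat_def rot_mat_def)

declare mat_of.simps [simp del]

lemma zeta_pow_inj: "zeta_pow l = zeta_pow l' \<Longrightarrow> l = l'"
  by (cases l; cases l') (auto simp: zeta_Complex complex_eq_iff)

lemma zeta_pow_nonzero [simp]: "zeta_pow l \<noteq> 0"
  by (cases l) (auto simp: zeta_Complex complex_eq_iff)

lemma unit_of_inj: "unit_of s t = unit_of s' t' \<Longrightarrow> s = s' \<and> t = t'"
  by (auto simp: unit_of_def complex_eq_iff split: if_splits)

lemma unit_of_nonzero [simp]: "unit_of s t \<noteq> 0"
  by (auto simp: unit_of_def)

text \<open>Vanishing off-diagonal entries detect \<open>None\<close>; the upper left entry gives
  the scalar, the lower right one then the power of \<open>A\<close>, and an off-diagonal one the
  index. This turns equations between matrices into equations between codes.\<close>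

lemma mat_of_inj: "inj mat_of"
proof (rule injI)
  fix x y assume eq: "mat_of x = mat_of y"
  obtain s t w l s' t' w' l' where x: "x = (s, t, w, l)" and y: "y = (s', t', w', l')"
    by (metis prod_cases4)
  show "x = y"
  proof (cases w; cases w')
    assume "w = None" "w' = None"
    then show ?thesis
      using eq unit_of_inj[of s t s' t'] zeta_pow_inj[of l l']
      by (auto simp: x y mat_of_entries)
  next
    fix j j' assume w: "w = Some j" "w' = Some j'"
    have 1: "s = s'" "t = t'"
      using eq unit_of_inj[of s t s' t'] by (auto simp: x y w mat_of_entries)
    have "l = l'"
      using eq 1 zeta_pow_inj[of l l'] by (auto simp: x y w mat_of_entries)
    moreover have "j = j'"
      using eq 1 calculation zeta_pow_inj[of j j'] by (auto simp: x y w mat_of_entries)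
    ultimately show ?thesis
      by (simp add: x y w 1)
  qed (use eq in \<open>auto simp: x y mat_of_entries\<close>)
qed

definition refl_det :: "z3 \<Rightarrow> complex" where
  "refl_det l = (if l = Z0 then - 1 else zeta_pow l)"

lemma det_mat_of:
  "det (mat_of (s, t, w, l)) = (if t = (w \<noteq> None) then zeta_pow l else - zeta_pow l)"
  by (cases w; cases "the w")
    (auto simp: mat_of_entries unit_of_def r3_square zeta_square field_simps)

lemma det_refl_code: "x \<in> set (refl_codes l) \<Longrightarrow> det (mat_of x) = refl_det l"
  by (cases l) (auto simp: det_mat_of refl_det_def)

lemma refl_det_inj: "refl_det l = refl_det l' \<Longrightarrow> l = l'"
  by (cases l; cases l') (auto simp: refl_det_def zeta_Complex complex_eq_iff)

section \<open>The group \<open>G\<^sub>6\<close>\<close>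

lemma invertible_mat_of: "invertible (mat_of x)"
  using mat_of_inv[of x] by (auto simp: invertible_left_inverse)

interpretation GL: group "GL :: (complex^2^2) monoid"
proof (rule groupI)
  fix x y z :: "complex^2^2"
  assume "x \<in> carrier GL" "y \<in> carrier GL" "z \<in> carrier GL"
  then show "x \<otimes>\<^bsub>GL\<^esub> y \<otimes>\<^bsub>GL\<^esub> z = x \<otimes>\<^bsub>GL\<^esub> (y \<otimes>\<^bsub>GL\<^esub> z)" "x \<otimes>\<^bsub>GL\<^esub> y \<in> carrier GL"
    by (auto simp: GL_def matrix_mul_assoc invertible_mult)
next
  fix x :: "complex^2^2"
  assume "x \<in> carrier GL"
  then have x: "invertible x" by (simp add: GL_def)
  show "\<one>\<^bsub>GL\<^esub> \<otimes>\<^bsub>GL\<^esub> x = x"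
    by (simp add: GL_def)
  obtain y where "x ** y = mat 1" "y ** x = mat 1"
    using x by (auto simp: invertible_def)
  then show "\<exists>y\<in>carrier GL. y \<otimes>\<^bsub>GL\<^esub> x = \<one>\<^bsub>GL\<^esub>"
    by (intro bexI[of _ y]) (auto simp: GL_def invertible_def)
next
  show "\<one>\<^bsub>GL\<^esub> \<in> carrier (GL :: (complex^2^2) monoid)"
    by (simp add: GL_def) (metis invertible_def matrix_mul_lid)
qed

lemma GL_simps [simp]: "mult GL = (**)" "one GL = mat 1"
  by (simp_all add: GL_def)

lemma G6_simps [simp]: "mult G6 = (**)" "one G6 = mat 1"
  by (simp_all add: G6_def)

lemma subgroup_range_mat_of: "subgroup (range mat_of) GL"
proof
  show "range mat_of \<subseteq> carrier GL"
    by (auto simp: GL_def invertible_mat_of)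
  then have inv: "inv\<^bsub>GL\<^esub> (mat_of x) = mat_of (code_inv x)" for x
    by (intro GL.inv_equality) (auto simp: mat_of_inv)
  fix M assume "M \<in> range mat_of"
  then show "inv\<^bsub>GL\<^esub> M \<in> range mat_of"
    by (auto simp: inv)
next
  show "\<one>\<^bsub>GL\<^esub> \<in> range mat_of"
    using mat_of_one by (metis GL_simps(2) rangeI)
qed (auto simp flip: mat_of_mult)

lemma carrier_G6: "carrier G6 = range mat_of"
proof
  show "carrier G6 \<subseteq> range mat_of"
    unfolding G6_def
    by (intro GL.subgroup_generated_minimal subgroup_range_mat_of) (auto simp: G6_A_eq G6_B_eq)
  interpret G6: group G6
    by (simp add: G6_def)
  let ?H = "{x. mat_of x \<in> carrier G6}"
  have mult: "code_mult x y \<in> ?H" if "x \<in> ?H" "y \<in> ?H" for x y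
    using G6.m_closed that mat_of_mult by (auto)
  have "{G6_A, G6_B} \<subseteq> carrier (GL :: (complex^2^2) monoid)"
    by (auto simp: GL_def G6_A_eq G6_B_eq invertible_mat_of)
  then have "{G6_A, G6_B} \<subseteq> carrier G6"
    unfolding G6_def by (rule GL.subgroup_generated_subset_carrier_subset)
  then have a: "(False, False, None, Z1) \<in> ?H" and b: "(False, False, Some Z1, Z0) \<in> ?H"
    by (auto simp: G6_A_eq G6_B_eq)
  have a2: "(False, False, None, Z2) \<in> ?H"
    using mult[OF a a] by simp
  have one: "code_one \<in> ?H"
    using mult[OF a a2] by simp
  have rot: "(False, False, None, l) \<in> ?H" for l
    by (cases l) (use a a2 one in auto)
  have b0: "(False, False, Some Z0, Z0) \<in> ?H"
    using mult[OF a mult[OF b a2]] by simp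
  have b2: "(False, False, Some Z2, Z0) \<in> ?H"
    using mult[OF a2 mult[OF b a]] by simp
  have quat: "(False, False, w, Z0) \<in> ?H" for w
    by (cases w; cases "the w") (use one b b0 b2 in auto)
  \<comment> \<open>The product of the involutions with indices 1, 0 and 2 is the scalar
    \<open>\<i>\<close>; all other scalars are its powers.\<close>
  have i: "(False, True, None, Z0) \<in> ?H"
    using mult[OF b mult[OF b0 b2]] by simp
  have m: "(True, False, None, Z0) \<in> ?H"
    using mult[OF i i] by simp
  have scal: "(s, t, None, Z0) \<in> ?H" for s t
    using one i m mult[OF i m] by (cases s; cases t) auto
  have zero: "z3_add a Z0 = a" for a
    by (cases a) auto
  have eq: "code_mult (s, t, None, Z0) (code_mult (False, False, w, Z0) (False, False, None, l)) = (s, t, w, l)"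
    for s t w l
    by (cases w) (simp_all add: zero)
  have "(s, t, w, l) \<in> ?H" for s t w l
    using mult[OF scal[of s t] mult[OF quat[of w] rot[of l]]] unfolding eq .
  then show "range mat_of \<subseteq> carrier G6"
    by (simp add: image_subset_iff split_paired_all)
qed

lemma mat_of_carrier [simp]: "mat_of x \<in> carrier G6"
  by (simp add: carrier_G6)

interpretation G6: group G6
  by (simp add: G6_def)

lemma mat_of_pow: "mat_of x [^]\<^bsub>G6\<^esub> n = mat_of (code_pow n x)"
proof (induction n)
  case (Suc n)
  then show ?case
    using G6.nat_pow_Suc2[of "mat_of x" n] by (simp add: mat_of_mult)
qed (simp add: mat_of_one)

lemma mat_of_pow_eq_one: "mat_of x [^]\<^bsub>G6\<^esub> n = \<one>\<^bsub>G6\<^esub> \<longleftrightarrow> code_pow n x = code_one"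
  using mat_of_inj by (metis G6_simps(2) injD mat_of_one mat_of_pow)

lemma code_order_facts:
  "code_pow 12 x = code_one"
  "\<lbrakk>code_pow 4 (s, t, w, l) \<noteq> code_one; code_pow 6 (s, t, w, l) \<noteq> code_one\<rbrakk> \<Longrightarrow> l \<noteq> Z0 \<and> t = (w = None)"
proof -
  have *: "order_facts y" for y
    using all_order_facts in_all_codes[of y] by (auto simp: list_all_iff)
  show "code_pow 12 x = code_one"
    using *[of x] by (cases x) simp
  show "\<lbrakk>code_pow 4 (s, t, w, l) \<noteq> code_one; code_pow 6 (s, t, w, l) \<noteq> code_one\<rbrakk> \<Longrightarrow> l \<noteq> Z0 \<and> t = (w = None)"
    using *[of "(s, t, w, l)"] by (auto split: if_splits)
qed

interpretation G6: torsion_group G6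
proof
  fix M assume "M \<in> carrier G6"
  then obtain x where "M = mat_of x"
    by (auto simp: carrier_G6)
  then have "M [^]\<^bsub>G6\<^esub> (12 :: nat) = \<one>\<^bsub>G6\<^esub>"
    by (simp only: mat_of_pow_eq_one code_order_facts)
  then show "\<exists>m>0. M [^]\<^bsub>G6\<^esub> (m :: nat) = \<one>\<^bsub>G6\<^esub>"
    by (intro exI[of _ 12]) simp
qed

abbreviation all_refl_codes :: "code list" where
  "all_refl_codes \<equiv> concat (map refl_codes [Z0, Z1, Z2])"

text \<open>The 14 matrices among which all reflections of \<open>G6\<close> lie. This explicit set
  is closed under conjugation by its members, hence under Hurwitz moves.\<close>

definition refl_mats :: "(complex^2^2) set" where
  "refl_mats = mat_of ` set all_refl_codes"

text \<open>In dimension 2 the hyperplane is a line: fixing everything would make \<open>t\<close>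
  the identity, and an invertible \<open>t - mat 1\<close> would leave only 0. Both conditions can
  be tested on codes.\<close>

lemma is_reflection_imp:
  assumes "is_reflection (t :: complex^2^2)"
  shows "det (t - mat 1) = 0" "t \<noteq> mat 1"
proof -
  have dim: "vec.dim (reflecting_hyperplane t) = 1"
    using assms unfolding is_reflection_def vec_dim_card by simp
  show "t \<noteq> mat 1"
  proof
    assume "t = mat 1"
    then have "reflecting_hyperplane t = UNIV"
      by (simp add: reflecting_hyperplane_def)
    then show False
      using dim unfolding \<open>reflecting_hyperplane t = UNIV\<close> vec_dim_card by simp
  qed
  show "det (t - mat 1) = 0"
  proof (rule ccontr)
    assume "det (t - mat 1) \<noteq> 0"
    then have "invertible (t - mat 1)"
      by (simp add: invertible_det_nz)
    then obtain M where "M ** (t - mat 1) = mat 1"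
      by (auto simp: invertible_left_inverse)
    then have "v = 0" if "(t - mat 1) *v v = 0" for v
      using that by (metis matrix_vector_mul_assoc matrix_vector_mul_lid matrix_vector_mult_0_right)
    then have "reflecting_hyperplane t \<subseteq> {0}"
      by (auto simp: reflecting_hyperplane_def)
    then show False
      using dim by (metis vec.dim_eq_0 zero_neq_one)
  qed
qed

text \<open>Coarse bounds suffice to refute the false equations in \<open>sqrt 3\<close> that arise
  when codes are tested one by one.\<close>

lemma sqrt3_bounds: "sqrt 3 > 17 / 10" "sqrt 3 < 18 / 10"
  by (rule real_less_rsqrt, simp add: power2_eq_square) (rule real_less_lsqrt, simp_all add: power2_eq_square)

lemma sqrt3_mult: "sqrt 3 * (sqrt 3 * x) = 3 * x"
  by (simp flip: mult.assoc)

lemma reflection_code: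
  assumes "is_reflection (mat_of x)"
  shows "x \<in> set all_refl_codes"
proof -
  obtain s t w l where x: "x = (s, t, w, l)"
    by (metis prod_cases4)
  have 1: "x \<noteq> code_one"
    using is_reflection_imp(2)[OF assms] mat_of_one by metis
  have 2: "det (mat_of x - mat 1) = 0"
    using is_reflection_imp(1)[OF assms] .
  show ?thesis
  proof (cases w)
    case None
    then show ?thesis
      using 1 2 by (cases l; cases s; cases t)
        (auto simp: x mat_of_entries mat_1_mk unit_of_def zeta_Complex complex_eq_iff)
  next
    case (Some j)
    then show ?thesis
      using 2 sqrt3_bounds by (cases l; cases j; cases s; cases t)
        (simp_all add: x mat_of_entries mat_1_mk unit_of_def zeta_Complex complex_eq_iff field_simps,
         simp_all add: sqrt3_mult)
  qed
qed

lemma reflections_G6: "reflections G6 \<subseteq> refl_mats"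
proof
  fix M assume "M \<in> reflections G6"
  then obtain x where "M = mat_of x" "is_reflection (mat_of x)"
    unfolding reflections_def carrier_G6 by blast
  then show "M \<in> refl_mats"
    unfolding refl_mats_def using reflection_code by blast
qed

section \<open>Coxeter elements\<close>

lemma reflecting_hyperplane_iff: "v \<in> reflecting_hyperplane t \<longleftrightarrow> t *v v = v"
  by (simp add: reflecting_hyperplane_def matrix_vector_mult_diff_rdistrib)

text \<open>Every proper divisor of 12 divides 4 or 6, so only the fourth and sixth powers have to
  be inspected.\<close>

lemma eq_12_of_dvd:
  assumes "(k :: nat) dvd 12" "\<not> k dvd 4" "\<not> k dvd 6"
  shows "k = 12"
proof -
  have "k \<le> 12"
    using assms(1) by (rule dvd_imp_le) simp
  then have "k = 0 \<or> k = 1 \<or> k = 2 \<or> k = 3 \<or> k = 4 \<or> k = 5 \<or> k = 6 \<or> k = 7 \<or> k = 8 \<or> k = 9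
      \<or> k = 10 \<or> k = 11 \<or> k = 12"
    by presburger
  then show ?thesis
    using assms by (elim disjE) simp_all
qed

lemma G6_ord_dvd: "G6.ord (mat_of x) dvd n \<longleftrightarrow> code_pow n x = code_one"
  using G6.pow_eq_id[of "mat_of x" n] by (simp add: mat_of_pow_eq_one del: G6_simps)

text \<open>An eigenvector of \<open>G6_B ** G6_A\<close>, with eigenvalue \<open>\<gamma>\<close>;
  it witnesses regularity of this element of order 12.\<close>

definition regular_vec :: "complex^2" where
  "regular_vec = vector [1, -1]"

lemma mk_regular_vec: "mk a b c d *v regular_vec = vector [a - b, c - d]"
  by (simp add: mk_def regular_vec_def vec_eq_iff forall_2 matrix_vector_mult_def sum_2)

lemma mk_fixes_regular_vec: "mk a b c d *v regular_vec = regular_vec \<longleftrightarrow> a - b = 1 \<and> c - d = - 1"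
  by (simp add: mk_regular_vec) (auto simp: regular_vec_def vec_eq_iff forall_2)

lemma regular_vec_not_in_hyperplane:
  assumes "x \<in> set all_refl_codes"
  shows "regular_vec \<notin> reflecting_hyperplane (mat_of x)"
  using assms sqrt3_bounds unfolding reflecting_hyperplane_iff
  by (auto simp: mat_of_entries mk_fixes_regular_vec unit_of_def zeta_Complex complex_eq_iff field_simps)

lemma ex_regular_12: "is_regular G6 12 (mat_of (False, False, Some Z1, Z1))"
proof -
  let ?x = "(False, False, Some Z1, Z1)"
  have "\<not> G6.ord (mat_of ?x) dvd 4" "\<not> G6.ord (mat_of ?x) dvd 6" "G6.ord (mat_of ?x) dvd 12"
    unfolding G6_ord_dvd by (simp_all add: code_order_facts(1)) (simp_all add: eval_nat_numeral)
  then have "G6.ord (mat_of ?x) = 12"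
    using eq_12_of_dvd by blast
  moreover have "is_eigenvector (mat_of ?x) regular_vec"
  proof -
    have "mat_of ?x *v regular_vec = \<gamma> *s regular_vec"
      by (simp add: mat_of_entries mk_regular_vec unit_of_def)
        (simp add: regular_vec_def vec_eq_iff forall_2 zeta_Complex gamma_Complex complex_eq_iff field_simps)
    moreover have "regular_vec \<noteq> 0"
      by (simp add: regular_vec_def vec_eq_iff forall_2)
    ultimately show ?thesis
      by (auto simp: is_eigenvector_def)
  qed
  moreover have "regular_vec \<notin> reflecting_hyperplane t" if "t \<in> reflections G6" for t
    using that reflections_G6 regular_vec_not_in_hyperplane unfolding refl_mats_def by blast
  ultimately show ?thesis
    unfolding is_regular_def by auto
qed

lemma coxeter_number_G6: "coxeter_number G6 = 12"
  unfolding coxeter_number_def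
proof (rule Greatest_equality)
  show "\<exists>g. is_regular G6 12 g"
    using ex_regular_12 by blast
  fix h assume "\<exists>g. is_regular G6 h g"
  then obtain x where "G6.ord (mat_of x) = h"
    by (auto simp: is_regular_def carrier_G6)
  then have "h dvd 12"
    using G6_ord_dvd code_order_facts(1) by blast
  then show "h \<le> 12"
    by (rule dvd_imp_le) simp
qed

lemma coxeter_element_det:
  assumes "is_coxeter_element G6 c"
  obtains l where "l \<noteq> Z0" "det c = - zeta_pow l"
proof -
  obtain s t w l where c: "c = mat_of (s, t, w, l)" and ord: "G6.ord c = 12"
    using assms by (auto simp: is_coxeter_element_def coxeter_number_G6 is_regular_def carrier_G6)
  have "\<not> G6.ord c dvd 4" "\<not> G6.ord c dvd 6"
    by (simp_all add: ord)
  then have "l \<noteq> Z0" "t = (w = None)"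
    using code_order_facts(2) unfolding c G6_ord_dvd by blast+
  then show thesis
    using that by (auto simp: c det_mat_of)
qed

section \<open>Reflection factorizations\<close>

lemma inv_mat_of: "inv\<^bsub>G6\<^esub> (mat_of x) = mat_of (code_inv x)"
  by (rule G6.inv_equality) (simp_all add: mat_of_inv)

lemma conj_by_mat_of: "conj_by G6 (mat_of g) (mat_of x) = mat_of (code_conj g x)"
  by (simp add: conj_by_def inv_mat_of code_conj_def mat_of_mult matrix_mul_assoc)

lemma det_conj_by: "\<lbrakk>g \<in> carrier G6; M \<in> carrier G6\<rbrakk> \<Longrightarrow> det (conj_by G6 g M) = det M"
proof -
  assume "g \<in> carrier G6" "M \<in> carrier G6"
  then obtain y x where *: "g = mat_of y" "M = mat_of x"
    by (auto simp: carrier_G6)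
  have "det (mat_of (code_inv y)) * det (mat_of y) = 1"
    by (metis det_I det_mul mat_of_inv)
  then show ?thesis
    by (simp add: * conj_by_mat_of code_conj_def mat_of_mult det_mul mult.commute mult.left_commute)
qed

lemma code_conj_refl:
  assumes "x \<in> set (refl_codes m)" "g \<in> set all_refl_codes"
  shows "code_conj g x \<in> set (refl_codes m)"
proof -
  have "[g, x] \<in> set (product_lists [all_refl_codes, refl_codes m])"
    using assms by (simp add: product_lists_set del: product_lists.simps)
  then have "conj_stable m [g, x]"
    using all_conj_stable unfolding list_all_iff by (cases m) blast+
  then show ?thesis
    by (simp add: conj_stable_def)
qed

lemma refl_mats_carrier: "refl_mats \<subseteq> carrier G6"
  by (auto simp: refl_mats_def)

lemma in_all_refl_codes: "x \<in> set all_refl_codes \<longleftrightarrow> (\<exists>m. x \<in> set (refl_codes m))"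
proof
  assume "\<exists>m. x \<in> set (refl_codes m)"
  then obtain m where "x \<in> set (refl_codes m)" ..
  then show "x \<in> set all_refl_codes"
    by (cases m) auto
next
  assume "x \<in> set all_refl_codes"
  then have "x \<in> set (refl_codes Z0) \<or> x \<in> set (refl_codes Z1) \<or> x \<in> set (refl_codes Z2)"
    by (simp del: refl_codes.simps)
  then show "\<exists>m. x \<in> set (refl_codes m)"
    by blast
qed

lemma refl_mats_cases:
  assumes "M \<in> refl_mats"
  obtains x l where "x \<in> set (refl_codes l)" "M = mat_of x" "det M = refl_det l"
  using assms det_refl_code unfolding refl_mats_def image_iff Bex_def in_all_refl_codes by blast

lemma conj_by_refl_mats:
  assumes "g \<in> refl_mats" "x \<in> refl_mats"
  shows "conj_by G6 g x \<in> refl_mats"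
proof -
  obtain g' where "g = mat_of g'" "g' \<in> set all_refl_codes"
    using assms(1) unfolding refl_mats_def by blast
  moreover obtain x' m where "x = mat_of x'" "x' \<in> set (refl_codes m)"
    using assms(2) refl_mats_cases by metis
  ultimately show ?thesis
    unfolding refl_mats_def using code_conj_refl conj_by_mat_of in_all_refl_codes by blast
qed

lemma orbit_refl_mats:
  assumes "U \<in> hurwitz_orbit G6 T" "set T \<subseteq> refl_mats"
  shows "set U \<subseteq> refl_mats"
  using assms by (rule hurwitz_orbit_invariant) (auto intro: conj_by_refl_mats)

text \<open>Counting by determinant is visibly invariant under conjugation and links the counts to
  the determinant of the product.\<close>

definition num :: "(complex^2^2) list \<Rightarrow> z3 \<Rightarrow> nat" where
  "num T l = count (image_mset det (mset T)) (refl_det l)"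

text \<open>What the induction retains of the Coxeter element: a condition on counts alone,
  inherited by the remainder once a block is removed.\<close>

definition coxeter_type :: "(complex^2^2) list \<Rightarrow> bool" where
  "coxeter_type T \<longleftrightarrow> odd (num T Z0) \<and> (num T Z1 + 2 * num T Z2) mod 3 \<noteq> 0"

lemma num_simps [simp]:
  "num [] l = 0"
  "num (M # T) l = (if det M = refl_det l then 1 else 0) + num T l"
  "num (T @ U) l = num T l + num U l"
  by (auto simp: num_def)

lemma refl_det_eq_iff [simp]: "refl_det l = refl_det l' \<longleftrightarrow> l = l'"
  using refl_det_inj by blast

lemma length_eq_num: "set T \<subseteq> refl_mats \<Longrightarrow> length T = num T Z0 + num T Z1 + num T Z2"
proof (induction T)
  case (Cons M T)
  obtain l where "det M = refl_det l"
    using refl_mats_cases[of M] Cons.prems by auto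
  then show ?case
    using Cons by (cases l) auto
qed simp

lemma det_list_mult:
  "set T \<subseteq> refl_mats \<Longrightarrow>
    det (list_mult G6 T) = (- 1) ^ num T Z0 * \<zeta> ^ num T Z1 * (- 1 - \<zeta>) ^ num T Z2"
proof (induction T)
  case (Cons M T)
  obtain l where l: "det M = refl_det l"
    using refl_mats_cases[of M] Cons.prems by auto
  have num: "num (M # T) l' = (if l = l' then 1 else 0) + num T l'" for l'
    using l by simp
  have det: "det (list_mult G6 (M # T)) = refl_det l * det (list_mult G6 T)"
    using l by (simp add: det_mul)
  show ?case
    using Cons unfolding det num by (cases l) (simp_all add: refl_det_def)
qed simp

lemma zeta_cube: "\<zeta> ^ 3 = 1"
  by (simp add: eval_nat_numeral zeta_square algebra_simps)

lemma coxeter_type_of_factorization: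
  assumes "is_coxeter_element G6 c" "is_reflection_factorization G6 c T"
  shows "coxeter_type T"
proof -
  have T: "set T \<subseteq> refl_mats" and prod: "list_mult G6 T = c"
    using assms(2) reflections_G6 by (auto simp: is_reflection_factorization_def)
  obtain l where l: "l \<noteq> Z0" "det c = - zeta_pow l"
    using coxeter_element_det[OF assms(1)] .
  let ?n = "num T Z1 + 2 * num T Z2"
  have "- 1 - \<zeta> = \<zeta> ^ 2"
    by (simp add: power2_eq_square zeta_square)
  then have eq: "(- 1) ^ num T Z0 * \<zeta> ^ ?n = - zeta_pow l"
    using det_list_mult[OF T] l prod by (simp add: power_mult power_add)
  have neq: "zeta_pow l \<noteq> - 1" "zeta_pow l \<noteq> 1"
    using l(1) by (cases l; simp add: zeta_Complex complex_eq_iff)+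
  have "odd (num T Z0)"
  proof
    assume "even (num T Z0)"
    \<comment> \<open>Cubing removes all powers of \<open>\<zeta>\<close> and leaves only signs; an
      even number of involutions would give 1 = -1.\<close>
    then have "(\<zeta> ^ ?n) ^ 3 = (- zeta_pow l) ^ 3"
      using eq by simp
    moreover have "(\<zeta> ^ ?n) ^ 3 = (\<zeta> ^ 3) ^ ?n"
      by (simp flip: power_mult add: mult.commute)
    moreover have "zeta_pow l ^ 3 = 1"
      by (cases l) (simp_all add: eval_nat_numeral zeta_square algebra_simps)
    ultimately show False
      by (simp add: zeta_cube)
  qed
  moreover have "?n mod 3 \<noteq> 0"
  proof
    assume "?n mod 3 = 0"
    then obtain k where "?n = 3 * k" by auto
    then have "\<zeta> ^ ?n = 1"
      by (simp add: power_mult zeta_cube)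
    then show False
      using eq neq calculation by simp
  qed
  ultimately show ?thesis
    by (simp add: coxeter_type_def)
qed

section \<open>Transfer of the checks on codes to factorizations\<close>

declare refl_codes.simps [simp del] product_lists.simps(2) [simp del]

lemma code_move_orbit: "map mat_of (code_move i S) \<in> hurwitz_orbit G6 (map mat_of S)"
proof (induction i S rule: code_move.induct)
  case (1 x y r)
  show ?case
    using hurwitz_orbit_pair[of "[]" "mat_of y" G6 "mat_of x" "map mat_of r"]
    by (simp add: conj_by_mat_of)
qed (auto intro: hurwitz_orbit_Cons_append hurwitz_orbit.refl)

lemma fold_code_move_orbit: "map mat_of (fold code_move p S) \<in> hurwitz_orbit G6 (map mat_of S)"
proof (induction p arbitrary: S)
  case (Cons i p)
  then show ?case
    using hurwitz_orbit_trans[OF Cons code_move_orbit] by simp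
qed (simp add: hurwitz_orbit.refl)

lemma search_orbit:
  assumes "search P ps S"
  obtains U where "P U" "map mat_of U \<in> hurwitz_orbit G6 (map mat_of S)"
  using assms by (induction ps) (auto split: if_splits intro: fold_code_move_orbit)

lemma product_lists_Cons:
  "S \<in> set (product_lists (xs # xss)) \<longleftrightarrow> (\<exists>x S'. S = x # S' \<and> x \<in> set xs \<and> S' \<in> set (product_lists xss))"
  by (auto simp: product_lists.simps(2))

lemma Cons_in_product_lists [simp]:
  "x # S \<in> set (product_lists (xs # xss)) \<longleftrightarrow> x \<in> set xs \<and> S \<in> set (product_lists xss)"
  by (auto simp: product_lists_Cons)

text \<open>Entries of prescribed classes are gathered at the front, in a prescribed order, and read
  as codes; the finite checks then apply to this front part.\<close>

lemma select_codes:
  assumes T: "set T \<subseteq> refl_mats" and le: "\<And>l. count (mset ls) l \<le> num T l"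
  obtains S R where "S \<in> set (product_lists (map refl_codes ls))" "map mat_of S @ R \<in> hurwitz_orbit G6 T"
proof -
  have "mset (map refl_det ls) \<subseteq># image_mset det (mset T)"
  proof (rule mset_subset_eqI)
    fix c
    show "count (mset (map refl_det ls)) c \<le> count (image_mset det (mset T)) c"
    proof (cases "c \<in> range refl_det")
      case True
      then obtain l where l: "c = refl_det l" by auto
      have "count (mset (map refl_det ls)) (refl_det l) = count (mset ls) l"
        by (induction ls) auto
      then show ?thesis
        using le[of l] by (simp add: l num_def)
    next
      case False
      then have "count (mset (map refl_det ls)) c = 0"
        by (intro count_eq_zero_iff[THEN iffD2]) auto
      then show ?thesis by simp
    qed
  qed
  moreover have "set T \<subseteq> carrier G6"
    using T refl_mats_carrier by simp
  ultimately obtain S' R where S': "S' @ R \<in> hurwitz_orbit G6 T" "map det S' = map refl_det ls"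
    using G6.hurwitz_orbit_select[of T "map refl_det ls" det, OF _ _ det_conj_by] by metis
  have "set S' \<subseteq> refl_mats"
    using orbit_refl_mats[OF S'(1) T] by simp
  with S'(2) have "\<exists>S. list_all2 (\<lambda>x ys. x \<in> set ys) S (map refl_codes ls) \<and> S' = map mat_of S"
  proof (induction ls arbitrary: S')
    case (Cons l ls)
    then obtain M S'' where M: "S' = M # S''" "det M = refl_det l" "map det S'' = map refl_det ls"
      by auto
    then obtain x where "x \<in> set (refl_codes l)" "M = mat_of x"
      using Cons.prems(2) refl_mats_cases[of M] by (metis list.set_intros(1) refl_det_eq_iff subsetD)
    moreover obtain S where "list_all2 (\<lambda>x ys. x \<in> set ys) S (map refl_codes ls)" "S'' = map mat_of S"
      using Cons.IH[of S''] Cons.prems M by auto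
    ultimately show ?case
      using M(1) by (intro exI[of _ "x # S"]) simp
  qed simp
  then show thesis
    using that S'(1) by (auto simp: product_lists_set)
qed

text \<open>A block of product 1 can be moved freely through a tuple. Here \<open>ls\<close> lists the classes of its entries.\<close>

definition good_block :: "(code \<Rightarrow> code list) \<Rightarrow> z3 \<Rightarrow> z3 list \<Rightarrow> bool" where
  "good_block g m ls \<longleftrightarrow> (\<forall>x\<in>set (refl_codes m).
     set (map mat_of (g x)) \<subseteq> refl_mats \<and>
     list_mult G6 (map mat_of (g x)) = mat 1 \<and>
     (\<forall>y. map (conj_by G6 (mat_of y)) (map mat_of (g x)) = map mat_of (g (code_conj y x))) \<and>
     (\<forall>l. num (map mat_of (g x)) l = count (mset ls) l))"

lemma mat_of_in_refl_mats: "x \<in> set (refl_codes m) \<Longrightarrow> mat_of x \<in> refl_mats"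
  unfolding refl_mats_def using in_all_refl_codes by blast

lemma good_square_block: "good_block square_block Z0 [Z0, Z0]"
  unfolding good_block_def square_block_def
proof (intro ballI conjI allI)
  fix x y l assume x: "x \<in> set (refl_codes Z0)"
  then have "code_mult x x = code_one"
    by (auto simp: refl_codes.simps)
  then have "mat_of x ** mat_of x = mat 1"
    by (metis mat_of_mult mat_of_one)
  then show "list_mult G6 (map mat_of [x, x]) = mat 1" by simp
  show "set (map mat_of [x, x]) \<subseteq> refl_mats"
    using x mat_of_in_refl_mats by simp
  show "num (map mat_of [x, x]) l = count (mset [Z0, Z0]) l"
    using det_refl_code[OF x] by simp
qed (simp add: conj_by_mat_of)

lemma good_cube_block:
  assumes "m \<noteq> Z0"
  shows "good_block cube_block m [m, m, m]"
  unfolding good_block_def cube_block_def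
proof (intro ballI conjI allI)
  fix x y l assume x: "x \<in> set (refl_codes m)"
  then have "code_mult x (code_mult x x) = code_one"
    using assms by (cases m) (auto simp: refl_codes.simps)
  then have "mat_of x ** (mat_of x ** mat_of x) = mat 1"
    by (metis mat_of_mult mat_of_one)
  then show "list_mult G6 (map mat_of [x, x, x]) = mat 1" by simp
  show "set (map mat_of [x, x, x]) \<subseteq> refl_mats"
    using x mat_of_in_refl_mats by simp
  show "num (map mat_of [x, x, x]) l = count (mset [m, m, m]) l"
    using det_refl_code[OF x] by simp
qed (simp add: conj_by_mat_of)

lemma good_pair_block: "good_block pair_block Z1 [Z1, Z2]"
  unfolding good_block_def pair_block_def
proof (intro ballI conjI allI)
  fix x y l assume x: "x \<in> set (refl_codes Z1)"
  then have inv: "code_inv x \<in> set (refl_codes Z2)"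
    by (auto simp: refl_codes.simps)
  show "list_mult G6 (map mat_of [x, code_inv x]) = mat 1"
    using G6.r_inv[of "mat_of x"] by (simp add: inv_mat_of)
  show "set (map mat_of [x, code_inv x]) \<subseteq> refl_mats"
    using x inv mat_of_in_refl_mats by simp
  show "num (map mat_of [x, code_inv x]) l = count (mset [Z1, Z2]) l"
    using det_refl_code[OF x] det_refl_code[OF inv] by simp
  show "map (conj_by G6 (mat_of y)) (map mat_of [x, code_inv x]) =
      map mat_of [code_conj y x, code_inv (code_conj y x)]"
    using G6.conj_by_inv[of "mat_of y" "mat_of x"] by (simp add: conj_by_mat_of flip: inv_mat_of)
qed

text \<open>Normalizes a block to the one given by the first code of its class, so that blocks split
  off from two factorizations become equal. The involution and the order-3 reflection that conjugate
  it are taken from \<open>w\<close>.\<close>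

lemma block_uniform:
  assumes g: "good_block g m ls" and w: "set w \<subseteq> refl_mats"
    and num: "num w Z0 > 0" "num w Z1 + num w Z2 > 0"
    and x: "x \<in> set (refl_codes m)"
  shows "map mat_of (g x) @ w \<in> hurwitz_orbit G6 (map mat_of (g (hd (refl_codes m))) @ w)"
proof -
  have ex: "\<exists>e\<in>set (refl_codes l). mat_of e \<in> set w" if pos: "num w l > 0" for l
  proof -
    obtain M where "M \<in> set w" "det M = refl_det l"
      using pos by (auto simp: num_def count_greater_zero_iff)
    then show ?thesis
      using w refl_mats_cases[of M] by (metis refl_det_eq_iff subsetD)
  qed
  obtain e where e: "e \<in> set (refl_codes Z0)" "mat_of e \<in> set w"
    using ex num(1) by blast
  obtain u where u: "u \<in> set (refl_codes Z1 @ refl_codes Z2)" "mat_of u \<in> set w"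
    using ex[of Z1] ex[of Z2] num(2) by (metis Un_iff add_is_0 gr0I set_append)
  let ?x0 = "hd (refl_codes m)"
  let ?Q = "\<lambda>y. y \<in> set (refl_codes m) \<and>
      map mat_of (g y) @ w \<in> hurwitz_orbit G6 (map mat_of (g ?x0) @ w)"
  have step: "?Q (code_conj a y)" if a: "a \<in> {e, u}" and y: "?Q y" for a y
  proof
    have "a \<in> set all_refl_codes"
      using a e u in_all_refl_codes by auto
    then show "code_conj a y \<in> set (refl_codes m)"
      using y code_conj_refl by blast
    have 1: "map (conj_by G6 (mat_of a)) (map mat_of (g y)) @ w \<in> hurwitz_orbit G6 (map mat_of (g y) @ w)"
    proof (rule G6.hurwitz_orbit_conj_block)
      show "mat_of a \<in> set w" "set w \<subseteq> carrier G6"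
        using a e u w refl_mats_carrier by auto
      show "set (map mat_of (g y)) \<subseteq> carrier G6"
        by auto
      show "list_mult G6 (map mat_of (g y)) = \<one>\<^bsub>G6\<^esub>"
        using g y by (simp add: good_block_def)
    qed
    have 2: "map (conj_by G6 (mat_of a)) (map mat_of (g y)) = map mat_of (g (code_conj a y))"
      using g y unfolding good_block_def by blast
    show "map mat_of (g (code_conj a y)) @ w \<in> hurwitz_orbit G6 (map mat_of (g ?x0) @ w)"
      using hurwitz_orbit_trans[OF 1[unfolded 2]] y by blast
  qed
  have spread: "\<forall>y\<in>set (spread n e u xs). ?Q y" if "\<forall>y\<in>set xs. ?Q y" for n xs
    using that
  proof (induction n arbitrary: xs)
    case (Suc n)
    show ?case
      unfolding spread.simps
    proof (rule Suc.IH)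
      show "\<forall>y\<in>set (remdups (xs @ map (code_conj e) xs @ map (code_conj u) xs)). ?Q y"
      proof
        fix y assume "y \<in> set (remdups (xs @ map (code_conj e) xs @ map (code_conj u) xs))"
        then have "y \<in> set xs \<or> (\<exists>a\<in>{e, u}. \<exists>z\<in>set xs. y = code_conj a z)"
          by auto
        then show "?Q y"
        proof
          assume "y \<in> set xs"
          with Suc.prems show "?Q y" ..
        next
          assume "\<exists>a\<in>{e, u}. \<exists>z\<in>set xs. y = code_conj a z"
          then obtain a z where a: "a \<in> {e, u}" and z: "z \<in> set xs" and y: "y = code_conj a z"
            by blast
          have "?Q z"
            using Suc.prems z ..
          then show "?Q y"
            unfolding y by (rule step[OF a])
        qed
      qed
    qed
  qed simp
  have "[e, u] \<in> set (product_lists [refl_codes Z0, refl_codes Z1 @ refl_codes Z2])"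
    using e u by simp
  then have "spreads m [e, u]"
    using all_spreads unfolding list_all_iff by (cases m) blast+
  then have "list_all (\<lambda>x. x \<in> set (spread 4 e u [?x0])) (refl_codes m)"
    unfolding spreads.simps .
  then have "x \<in> set (spread 4 e u [?x0])"
    using x unfolding list_all_iff ..
  moreover have "?x0 \<in> set (refl_codes m)"
    by (cases m) (auto simp: refl_codes.simps)
  then have "\<forall>y\<in>set [?x0]. ?Q y"
    by (simp add: hurwitz_orbit.refl)
  then have "\<forall>y\<in>set (spread 4 e u [?x0]). ?Q y"
    by (rule spread)
  ultimately show ?thesis
    by blast
qed

lemma has_blockE:
  assumes "has_block g m S"
  obtains xs x ys where "x \<in> set (refl_codes m)" "S = xs @ g x @ ys"
proof -
  have pre: "code_prefix xs ys \<Longrightarrow> \<exists>zs. ys = xs @ zs" for xs ys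
    by (induction xs ys rule: code_prefix.induct) (auto split: if_splits)
  have "\<exists>xs x ys. x \<in> set (refl_codes m) \<and> S = xs @ g x @ ys"
    using assms
  proof (induction S)
    case (Cons y S)
    then consider "y \<in> set (refl_codes m)" "code_prefix (g y) (y # S)" | "has_block g m S"
      by auto
    then show ?case
    proof cases
      case 1
      then show ?thesis
        using pre by (metis append_Nil)
    next
      case 2
      then show ?thesis
        using Cons.IH by (metis append_Cons)
    qed
  qed simp
  then show thesis
    using that by blast
qed

lemma block_to_front:
  assumes T: "set T \<subseteq> refl_mats" and g: "good_block g m ls"
    and S: "map mat_of S @ R \<in> hurwitz_orbit G6 T" "has_block g m S"
  obtains x w where "x \<in> set (refl_codes m)" "map mat_of (g x) @ w \<in> hurwitz_orbit G6 T"
proof -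
  obtain xs x ys where x: "x \<in> set (refl_codes m)" "S = xs @ g x @ ys"
    using has_blockE[OF S(2)] .
  have "map mat_of (g x) @ map mat_of xs \<in> hurwitz_orbit G6 (map mat_of xs @ map mat_of (g x))"
    using g x(1) by (intro G6.hurwitz_orbit_to_front) (auto simp: good_block_def)
  then have "(map mat_of (g x) @ map mat_of xs) @ (map mat_of ys @ R) \<in>
      hurwitz_orbit G6 ((map mat_of xs @ map mat_of (g x)) @ (map mat_of ys @ R))"
    by (rule hurwitz_orbit_Cons_append)
  then have "map mat_of (g x) @ (map mat_of xs @ map mat_of ys @ R) \<in> hurwitz_orbit G6 T"
    using hurwitz_orbit_trans[OF _ S(1)] x(2) by simp
  then show thesis
    using that x(1) by blast
qed

lemma extract_block:
  assumes T: "set T \<subseteq> refl_mats" and g: "good_block g m ls'"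
    and le: "\<And>l. count (mset ls) l \<le> num T l"
    and all: "list_all (search (has_block g m) ps) (product_lists (map refl_codes ls))"
  obtains x w where "x \<in> set (refl_codes m)" "map mat_of (g x) @ w \<in> hurwitz_orbit G6 T"
proof -
  obtain S R where S: "S \<in> set (product_lists (map refl_codes ls))" "map mat_of S @ R \<in> hurwitz_orbit G6 T"
    using select_codes[OF T le] .
  then have "search (has_block g m) ps S"
    using all by (auto simp: list_all_iff)
  then obtain U where U: "has_block g m U" "map mat_of U \<in> hurwitz_orbit G6 (map mat_of S)"
    by (rule search_orbit)
  have "map mat_of U @ R \<in> hurwitz_orbit G6 T"
    using hurwitz_orbit_trans[OF hurwitz_orbit_Cons_append(2)[OF U(2)] S(2)] .
  then show thesis
    using block_to_front[OF T g _ U(1)] that by blast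
qed

lemma extract_square:
  assumes "set T \<subseteq> refl_mats" "num T Z0 \<ge> 3" "num T Z1 + num T Z2 > 0"
  obtains x w where "x \<in> set (refl_codes Z0)" "map mat_of (square_block x) @ w \<in> hurwitz_orbit G6 T"
proof (cases "num T Z1 > 0")
  case True
  have "count (mset [Z0, Z0, Z0, Z1]) l \<le> num T l" for l
    using assms True by (cases l) auto
  then show thesis
    using extract_block[OF assms(1) good_square_block] all_square(1) that
    by (metis (no_types, lifting) list.simps(8,9))
next
  case False
  have "count (mset [Z0, Z0, Z0, Z2]) l \<le> num T l" for l
    using assms False by (cases l) auto
  then show thesis
    using extract_block[OF assms(1) good_square_block] all_square(2) that
    by (metis (no_types, lifting) list.simps(8,9))
qed

lemma extract_pair:
  assumes "set T \<subseteq> refl_mats" "num T Z0 > 0" "num T Z1 > 0" "num T Z2 > 0" "num T Z1 + num T Z2 > 2"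
  obtains x w where "x \<in> set (refl_codes Z1)" "map mat_of (pair_block x) @ w \<in> hurwitz_orbit G6 T"
proof (cases "num T Z1 > 1")
  case True
  have "count (mset [Z0, Z1, Z1, Z2]) l \<le> num T l" for l
    using assms True by (cases l) auto
  then show thesis
    using extract_block[OF assms(1) good_pair_block] all_pair(1) that
    by (metis (no_types, lifting) list.simps(8,9))
next
  case False
  have "count (mset [Z0, Z2, Z2, Z1]) l \<le> num T l" for l
    using assms False by (cases l) auto
  then show thesis
    using extract_block[OF assms(1) good_pair_block] all_pair(2) that
    by (metis (no_types, lifting) list.simps(8,9))
qed

lemma doubled_right_orbit:
  assumes "m \<noteq> Z0" "e \<in> set (refl_codes Z0)" "u \<in> set (refl_codes m)" "v \<in> set (refl_codes m)"
  obtains e' x where "e' \<in> set (refl_codes Z0)" "x \<in> set (refl_codes m)"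
    "map mat_of [e', x, x] \<in> hurwitz_orbit G6 (map mat_of [e, u, v])"
proof -
  have "[e, u, v] \<in> set (product_lists [refl_codes Z0, refl_codes m, refl_codes m])"
    using assms by simp
  then have "search (doubled_right m) double_paths [e, u, v]"
    using assms(1) all_doubled_right unfolding list_all_iff by (cases m) blast+
  then obtain U where "doubled_right m U" "map mat_of U \<in> hurwitz_orbit G6 (map mat_of [e, u, v])"
    by (rule search_orbit)
  then show thesis
    using that by (cases "(m, U)" rule: doubled_right.cases) auto
qed

lemma doubled_left_orbit:
  assumes "m \<noteq> Z0" "e \<in> set (refl_codes Z0)" "u \<in> set (refl_codes m)" "v \<in> set (refl_codes m)"
  obtains e' x where "e' \<in> set (refl_codes Z0)" "x \<in> set (refl_codes m)"
    "map mat_of [x, x, e'] \<in> hurwitz_orbit G6 (map mat_of [e, u, v])"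
proof -
  have "[e, u, v] \<in> set (product_lists [refl_codes Z0, refl_codes m, refl_codes m])"
    using assms by simp
  then have "search (doubled_left m) (map (\<lambda>p. p @ [0, 1]) double_paths) [e, u, v]"
    using assms(1) all_doubled_left unfolding list_all_iff by (cases m) blast+
  then obtain U where "doubled_left m U" "map mat_of U \<in> hurwitz_orbit G6 (map mat_of [e, u, v])"
    by (rule search_orbit)
  then show thesis
    using that by (cases "(m, U)" rule: doubled_left.cases) auto
qed

text \<open>One involution serves twice: it first doubles \<open>a, b\<close> to its left, and the
  involution so obtained then doubles \<open>c, d\<close> to its right. The resulting
  \<open>x, x, e'', y, y\<close> is the form covered by \<open>cube_search\<close>.\<close>

lemma extract_cube:
  assumes T: "set T \<subseteq> refl_mats" and m: "m \<noteq> Z0" and num: "num T Z0 > 0" "num T m \<ge> 4"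
  obtains x w where "x \<in> set (refl_codes m)" "map mat_of (cube_block x) @ w \<in> hurwitz_orbit G6 T"
proof -
  have "count (mset [Z0, m, m, m, m]) l \<le> num T l" for l
    using num m by auto
  then obtain S R where S: "S \<in> set (product_lists (map refl_codes [Z0, m, m, m, m]))"
      "map mat_of S @ R \<in> hurwitz_orbit G6 T"
    using select_codes[OF T] by blast
  then obtain e a b c d where S_eq: "S = [e, a, b, c, d]" and e: "e \<in> set (refl_codes Z0)"
    and abcd: "a \<in> set (refl_codes m)" "b \<in> set (refl_codes m)" "c \<in> set (refl_codes m)" "d \<in> set (refl_codes m)"
    by (auto simp: product_lists_Cons)
  obtain e' x where e': "e' \<in> set (refl_codes Z0)" "x \<in> set (refl_codes m)"
    "map mat_of [x, x, e'] \<in> hurwitz_orbit G6 (map mat_of [e, a, b])"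
    using doubled_left_orbit[OF m e abcd(1,2)] .
  obtain e'' y where e'': "e'' \<in> set (refl_codes Z0)" "y \<in> set (refl_codes m)"
    "map mat_of [e'', y, y] \<in> hurwitz_orbit G6 (map mat_of [e', c, d])"
    using doubled_right_orbit[OF m e'(1) abcd(3,4)] .
  have "map mat_of [x, x, e', c, d] \<in> hurwitz_orbit G6 (map mat_of [e, a, b, c, d])"
    using hurwitz_orbit_Cons_append(2)[OF e'(3), of "map mat_of [c, d]"] by simp
  moreover have "map mat_of [x, x, e'', y, y] \<in> hurwitz_orbit G6 (map mat_of [x, x, e', c, d])"
    using hurwitz_orbit_Cons_append(3)[OF e''(3), of "map mat_of [x, x]"] by simp
  moreover
  have "[x, e'', y] \<in> set (product_lists [refl_codes m, refl_codes Z0, refl_codes m])"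
    using e' e'' by simp
  then have "cube_search m [x, e'', y]"
    using m all_cube unfolding list_all_iff by (cases m) blast+
  then have "search (has_block cube_block m) [[1], [2], [1, 1, 1], [2, 2, 2]] [x, x, e'', y, y]"
    unfolding cube_search.simps .
  then obtain U where U: "has_block cube_block m U" "map mat_of U \<in> hurwitz_orbit G6 (map mat_of [x, x, e'', y, y])"
    by (rule search_orbit)
  ultimately have "map mat_of U \<in> hurwitz_orbit G6 (map mat_of S)"
    unfolding S_eq by (meson hurwitz_orbit_trans)
  then have "map mat_of U @ R \<in> hurwitz_orbit G6 T"
    using hurwitz_orbit_trans[OF hurwitz_orbit_Cons_append(2) S(2)] by blast
  then show thesis
    using block_to_front[OF T good_cube_block[OF m] _ U(1)] that by blast
qed


text \<open>Both tuples reach the same standard block \<open>?z\<close>, followed by remainders with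
  equal products and counts. The induction hypothesis joins the remainders, and the path to
  \<open>T'\<close> is completed by reversing moves.\<close>

lemma cancel_blocks:
  assumes T: "set T \<subseteq> refl_mats" and T': "set T' \<subseteq> refl_mats"
    and prod: "list_mult G6 T = list_mult G6 T'" and num: "\<And>l. num T l = num T' l"
    and g: "good_block g m ls" and ls: "ls \<in> {[Z0, Z0], [Z1, Z2], [Z1, Z1, Z1], [Z2, Z2, Z2]}"
    and cox: "coxeter_type T"
    and IH: "\<And>w w'. \<lbrakk>length w < length T; set w \<subseteq> refl_mats; set w' \<subseteq> refl_mats;
      list_mult G6 w = list_mult G6 w'; \<And>l. num w l = num w' l; coxeter_type w\<rbrakk>
      \<Longrightarrow> w' \<in> hurwitz_orbit G6 w"
    and x: "x \<in> set (refl_codes m)" "map mat_of (g x) @ w \<in> hurwitz_orbit G6 T"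
    and x': "x' \<in> set (refl_codes m)" "map mat_of (g x') @ w' \<in> hurwitz_orbit G6 T'"
  shows "T' \<in> hurwitz_orbit G6 T"
proof -
  have num_orbit: "num U l = num V l" if "U \<in> hurwitz_orbit G6 V" "set V \<subseteq> refl_mats" for U V l
    using G6.hurwitz_orbit_image_mset[OF that(1) _ det_conj_by] that(2) refl_mats_carrier
    by (simp add: num_def)
  have block: "set w \<subseteq> refl_mats" "list_mult G6 w = list_mult G6 T" "\<And>l. num T l = count (mset ls) l + num w l"
    if T: "set T \<subseteq> refl_mats" and x: "x \<in> set (refl_codes m)" "map mat_of (g x) @ w \<in> hurwitz_orbit G6 T" for T x w
  proof -
    show w: "set w \<subseteq> refl_mats"
      using orbit_refl_mats[OF x(2) T] by simp
    have Tc: "set T \<subseteq> carrier G6" and wc: "set w \<subseteq> carrier G6"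
      using T w refl_mats_carrier by auto
    have "list_mult G6 T = list_mult G6 (map mat_of (g x) @ w)"
      using G6.hurwitz_orbit_list_mult[OF x(2) Tc] by simp
    also have "\<dots> = list_mult G6 (map mat_of (g x)) \<otimes>\<^bsub>G6\<^esub> list_mult G6 w"
      using wc by (intro G6.list_mult_append) auto
    also have "list_mult G6 (map mat_of (g x)) = \<one>\<^bsub>G6\<^esub>"
      using g x(1) by (simp add: good_block_def)
    also have "\<one>\<^bsub>G6\<^esub> \<otimes>\<^bsub>G6\<^esub> list_mult G6 w = list_mult G6 w"
      by simp
    finally show "list_mult G6 w = list_mult G6 T" ..
    show "num T l = count (mset ls) l + num w l" for l
      using num_orbit[OF x(2) T, of l] g x(1) by (simp add: good_block_def)
  qed
  note w = block[OF T x] and w' = block[OF T' x']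
  \<comment> \<open>A block contains 0 or 2 involutions and contributes 0, 3 or 6 to
    \<open>num T Z1 + 2 * num T Z2\<close>.\<close>
  have cw: "coxeter_type w"
    using ls cox w(3)[of Z0] w(3)[of Z1] w(3)[of Z2] unfolding coxeter_type_def
    by (elim insertE) (simp_all, presburger+)
  have num': "num w l = num w' l" for l
    using w(3)[of l] w'(3)[of l] num[of l] by simp
  have pos: "num w Z0 > 0" "num w Z1 + num w Z2 > 0" "num w' Z0 > 0" "num w' Z1 + num w' Z2 > 0"
    using cw num' by (auto simp: coxeter_type_def odd_pos intro!: Nat.gr0I)
  have carrier: "set (map mat_of (g y) @ v) \<subseteq> carrier G6" if "set v \<subseteq> refl_mats" for y v
    using that refl_mats_carrier by auto
  let ?z = "map mat_of (g (hd (refl_codes m)))"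
  have "length (map mat_of (g x) @ w) = length T"
    by (rule hurwitz_orbit_length[OF x(2)])
  moreover have "g x \<noteq> []"
  proof
    assume "g x = []"
    then have "count (mset ls) l = 0" for l
      using g x(1) unfolding good_block_def by (metis list.simps(8) num_simps(1))
    then show False
      using ls by (metis insertE emptyE list.set_intros(1) count_mset_0_iff)
  qed
  ultimately have "length w < length T"
    by (metis add.commute length_append length_greater_0_conv length_map less_add_same_cancel1)
  then have "w' \<in> hurwitz_orbit G6 w"
    using w w' prod num' cw by (intro IH) auto
  then have "?z @ w' \<in> hurwitz_orbit G6 (?z @ w)"
    by (rule hurwitz_orbit_Cons_append)
  moreover have "?z @ w \<in> hurwitz_orbit G6 (map mat_of (g x) @ w)"
    using G6.hurwitz_orbit_sym[OF block_uniform[OF g w(1) pos(1,2) x(1)] carrier[OF w(1)]] .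
  moreover have "map mat_of (g x') @ w' \<in> hurwitz_orbit G6 (?z @ w')"
    using block_uniform[OF g w'(1) pos(3,4) x'(1)] .
  moreover have "T' \<in> hurwitz_orbit G6 (map mat_of (g x') @ w')"
    using G6.hurwitz_orbit_sym[OF x'(2)] T' refl_mats_carrier by auto
  ultimately show ?thesis
    using x(2) by (meson hurwitz_orbit_trans)
qed

text \<open>Both tuples are put in the class order \<open>ls\<close>, with equal last entries in the
  case of three. By \<open>mat_of_inj\<close> equal products give equal codes, and the checks then
  provide a power of the full twist from one to the other.\<close>

lemma base_case:
  assumes T: "set T \<subseteq> refl_mats" and T': "set T' \<subseteq> refl_mats"
    and prod: "list_mult G6 T = list_mult G6 T'" and num: "\<And>l. num T l = num T' l"
    and m: "m \<noteq> Z0" and len: "length T = length ls"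
    and ls: "ls = [Z0, m] \<or> ls = [Z0, m, m]" "\<And>l. num T l = count (mset ls) l"
  shows "T' \<in> hurwitz_orbit G6 T"
proof -
  have select: "\<exists>S. S \<in> set (product_lists (map refl_codes ls)) \<and> map mat_of S \<in> hurwitz_orbit G6 T"
    if T: "set T \<subseteq> refl_mats" and num: "\<And>l. num T l = count (mset ls) l" and len: "length T = length ls" for T
  proof -
    obtain S R where S: "S \<in> set (product_lists (map refl_codes ls))" "map mat_of S @ R \<in> hurwitz_orbit G6 T"
      using select_codes[OF T, of ls] num by auto
    have "length S = length ls"
      using S(1) in_set_product_lists_length by fastforce
    then have "R = []"
      using hurwitz_orbit_length[OF S(2)] len by simp
    then show ?thesis
      using S by auto
  qed
  have len': "length T' = length ls"
    using length_eq_num[OF T] length_eq_num[OF T'] num len by simp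
  have carrier: "set T \<subseteq> carrier G6" "set T' \<subseteq> carrier G6"
    using T T' refl_mats_carrier by auto
  have join: "T' \<in> hurwitz_orbit G6 T"
    if U: "map mat_of U \<in> hurwitz_orbit G6 T" and U': "map mat_of U' \<in> hurwitz_orbit G6 T'"
      and UU': "search (code_prefix U') ps U" "length U = length U'" for U U' ps
  proof -
    obtain V where V: "code_prefix U' V" "map mat_of V \<in> hurwitz_orbit G6 (map mat_of U)"
      using search_orbit[OF UU'(1)] .
    have "length V = length U'"
      using hurwitz_orbit_length[OF V(2)] UU'(2) by simp
    moreover have "code_prefix xs ys \<Longrightarrow> length ys = length xs \<Longrightarrow> ys = xs" for xs ys
      by (induction xs ys rule: code_prefix.induct) (auto split: if_splits)
    ultimately have "V = U'"
      using V(1) by blast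
    moreover have "T' \<in> hurwitz_orbit G6 (map mat_of U')"
      using G6.hurwitz_orbit_sym[OF U' carrier(2)] .
    ultimately show ?thesis
      using V(2) U by (meson hurwitz_orbit_trans)
  qed
  have prods: "list_mult G6 (map mat_of U) = list_mult G6 (map mat_of U')"
    if "map mat_of U \<in> hurwitz_orbit G6 T" "map mat_of U' \<in> hurwitz_orbit G6 T'" for U U'
    using G6.hurwitz_orbit_list_mult[OF that(1) carrier(1)] G6.hurwitz_orbit_list_mult[OF that(2) carrier(2)] prod
    by simp
  obtain S S' where S: "S \<in> set (product_lists (map refl_codes ls))" "map mat_of S \<in> hurwitz_orbit G6 T"
    and S': "S' \<in> set (product_lists (map refl_codes ls))" "map mat_of S' \<in> hurwitz_orbit G6 T'"
    using select[OF T ls(2) len] select[OF T' _ len'] ls(2) num by metis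
  from ls(1) show ?thesis
  proof
    assume "ls = [Z0, m]"
    then obtain e u e' u' where eu: "S = [e, u]" "e \<in> set (refl_codes Z0)" "u \<in> set (refl_codes m)"
      and eu': "S' = [e', u']" "e' \<in> set (refl_codes Z0)" "u' \<in> set (refl_codes m)"
      using S(1) S'(1) by (auto simp: product_lists_Cons)
    have "mat_of (code_mult e u) = mat_of (code_mult e' u')"
      using prods[OF S(2) S'(2)] by (simp add: eu(1) eu'(1) mat_of_mult)
    then have eq: "code_mult e u = code_mult e' u'"
      using mat_of_inj by (rule injD[rotated])
    have "[e, u, e', u'] \<in> set (product_lists [refl_codes Z0, refl_codes m, refl_codes Z0, refl_codes m])"
      using eu eu' by simp
    then have "twists_to2 [e, u, e', u']"
      using m all_twists_to2 unfolding list_all_iff by (cases m) blast+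
    then have "search (code_prefix [e', u']) [[], [0, 0], [0, 0, 0, 0]] [e, u]"
      using eq unfolding twists_to2.simps by presburger
    then have "search (code_prefix S') [[], [0, 0], [0, 0, 0, 0]] S"
      unfolding eu(1) eu'(1) .
    moreover have "length S = length S'"
      by (simp add: eu(1) eu'(1))
    ultimately show ?thesis
      by (rule join[OF S(2) S'(2)])
  next
    assume "ls = [Z0, m, m]"
    then obtain e u v e' u' v' where eu: "S = [e, u, v]" "e \<in> set (refl_codes Z0)" "u \<in> set (refl_codes m)" "v \<in> set (refl_codes m)"
      and eu': "S' = [e', u', v']" "e' \<in> set (refl_codes Z0)" "u' \<in> set (refl_codes m)" "v' \<in> set (refl_codes m)"
      using S(1) S'(1) by (auto simp: product_lists_Cons)
    obtain d x where d: "d \<in> set (refl_codes Z0)" "x \<in> set (refl_codes m)"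
      "map mat_of [d, x, x] \<in> hurwitz_orbit G6 T"
    proof (rule doubled_right_orbit[OF m eu(2-4)])
      fix d x
      assume "d \<in> set (refl_codes Z0)" "x \<in> set (refl_codes m)"
        "map mat_of [d, x, x] \<in> hurwitz_orbit G6 (map mat_of [e, u, v])"
      then show thesis
        using that hurwitz_orbit_trans[OF _ S(2)] unfolding eu(1) by blast
    qed
    obtain d' x' where d': "d' \<in> set (refl_codes Z0)" "x' \<in> set (refl_codes m)"
      "map mat_of [d', x', x'] \<in> hurwitz_orbit G6 T'"
    proof (rule doubled_right_orbit[OF m eu'(2-4)])
      fix d x
      assume "d \<in> set (refl_codes Z0)" "x \<in> set (refl_codes m)"
        "map mat_of [d, x, x] \<in> hurwitz_orbit G6 (map mat_of [e', u', v'])"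
      then show thesis
        using that hurwitz_orbit_trans[OF _ S'(2)] unfolding eu'(1) by blast
    qed
    have "mat_of (code_mult d (code_mult x x)) = mat_of (code_mult d' (code_mult x' x'))"
      using prods[OF d(3) d'(3)] by (simp add: mat_of_mult)
    then have eq: "code_mult d (code_mult x x) = code_mult d' (code_mult x' x')"
      using mat_of_inj by (rule injD[rotated])
    have "[d, x, d', x'] \<in> set (product_lists [refl_codes Z0, refl_codes m, refl_codes Z0, refl_codes m])"
      using d d' by simp
    then have "twists_to3 [d, x, d', x']"
      using m all_twists_to3 unfolding list_all_iff by (cases m) blast+
    then have "search (code_prefix [d', x', x']) [[], [0, 1, 0, 1, 0, 1], [0, 1, 0, 1, 0, 1, 0, 1, 0, 1, 0, 1]] [d, x, x]"
      using eq unfolding twists_to3.simps by presburger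
    then show ?thesis
      by (rule join[OF d(3) d'(3)]) simp
  qed
qed

lemma hurwitz_transitive:
  assumes "set T \<subseteq> refl_mats" "set T' \<subseteq> refl_mats" "list_mult G6 T = list_mult G6 T'"
    and "\<And>l. num T l = num T' l" "coxeter_type T"
  shows "T' \<in> hurwitz_orbit G6 T"
  using assms
proof (induction "length T" arbitrary: T T' rule: less_induct)
  case less
  note T = less.prems(1) and T' = less.prems(2) and num = less.prems(4)
  note cancel = cancel_blocks[OF T T' less.prems(3) num]
  have odd: "odd (num T Z0)" and mod: "(num T Z1 + 2 * num T Z2) mod 3 \<noteq> 0"
    using less.prems(5) by (auto simp: coxeter_type_def)
  have pos: "num T Z0 > 0" "num T Z1 + num T Z2 > 0"
    using odd mod by (auto simp: odd_pos intro!: Nat.gr0I)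
  consider "num T Z0 \<ge> 3" | "num T Z1 > 0" "num T Z2 > 0" | m where "m \<noteq> Z0" "num T m \<ge> 4"
    | m where "m \<noteq> Z0" "num T Z0 = 1" "num T m = 1 \<or> num T m = 2" "\<And>l. l \<noteq> Z0 \<Longrightarrow> l \<noteq> m \<Longrightarrow> num T l = 0"
  proof -
    have "num T Z0 \<ge> 3 \<or> num T Z0 = 1"
      using odd by presburger
    then consider (ge) "num T Z0 \<ge> 3" | (one) "num T Z0 = 1"
      by blast
    then show thesis
    proof cases
      case one
      \<comment> \<open>If only one class of order 3 occurs, fewer than four times, its number is 1
        or 2: the values 0 and 3 violate the congruence.\<close>
      have "num T Z1 > 0 \<and> num T Z2 > 0 \<or> num T Z1 \<ge> 4 \<or> num T Z2 \<ge> 4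
          \<or> num T Z2 = 0 \<and> (num T Z1 = 1 \<or> num T Z1 = 2) \<or> num T Z1 = 0 \<and> (num T Z2 = 1 \<or> num T Z2 = 2)"
        using mod by presburger
      then consider "num T Z1 > 0" "num T Z2 > 0" | "num T Z1 \<ge> 4" | "num T Z2 \<ge> 4"
        | "num T Z2 = 0" "num T Z1 = 1 \<or> num T Z1 = 2" | "num T Z1 = 0" "num T Z2 = 1 \<or> num T Z2 = 2"
        by (elim disjE) auto
      then show thesis
      proof cases
        case 4
        have "num T l = 0" if "l \<noteq> Z0" "l \<noteq> Z1" for l
          using that 4(1) by (cases l) auto
        then show thesis
          using that(4)[of Z1] one 4(2) by blast
      next
        case 5
        have "num T l = 0" if "l \<noteq> Z0" "l \<noteq> Z2" for l
          using that 5(1) by (cases l) auto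
        then show thesis
          using that(4)[of Z2] one 5(2) by blast
      qed (use that in blast)+
    qed (use that in blast)
  qed
  then show ?case
  proof cases
    case 1
    show ?thesis
    proof (rule extract_square[OF T 1 pos(2)])
      fix x w assume x: "x \<in> set (refl_codes Z0)" "map mat_of (square_block x) @ w \<in> hurwitz_orbit G6 T"
      show ?thesis
      proof (rule extract_square[OF T'])
        fix x' w' assume x': "x' \<in> set (refl_codes Z0)" "map mat_of (square_block x') @ w' \<in> hurwitz_orbit G6 T'"
        show ?thesis
        proof (rule cancel[OF good_square_block _ less.prems(5) _ x x'])
          fix v v' assume "length v < length T" "set v \<subseteq> refl_mats" "set v' \<subseteq> refl_mats"
            "list_mult G6 v = list_mult G6 v'" "\<And>l. num v l = num v' l" "coxeter_type v"
          then show "v' \<in> hurwitz_orbit G6 v"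
            by (rule less.hyps)
        qed simp
      qed (use 1 pos num in auto)
    qed
  next
    case 2
    \<comment> \<open>One reflection of each of the two classes would give 1 + 2 = 3, which the
      congruence excludes.\<close>
    have gt: "num T Z1 + num T Z2 > 2"
      using 2 mod by presburger
    show ?thesis
    proof (rule extract_pair[OF T pos(1) 2 gt])
      fix x w assume x: "x \<in> set (refl_codes Z1)" "map mat_of (pair_block x) @ w \<in> hurwitz_orbit G6 T"
      show ?thesis
      proof (rule extract_pair[OF T'])
        fix x' w' assume x': "x' \<in> set (refl_codes Z1)" "map mat_of (pair_block x') @ w' \<in> hurwitz_orbit G6 T'"
        show ?thesis
        proof (rule cancel[OF good_pair_block _ less.prems(5) _ x x'])
          fix v v' assume "length v < length T" "set v \<subseteq> refl_mats" "set v' \<subseteq> refl_mats"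
            "list_mult G6 v = list_mult G6 v'" "\<And>l. num v l = num v' l" "coxeter_type v"
          then show "v' \<in> hurwitz_orbit G6 v"
            by (rule less.hyps)
        qed simp
      qed (use 2 gt pos num in auto)
    qed
  next
    case (3 m)
    show ?thesis
    proof (rule extract_cube[OF T 3(1) pos(1) 3(2)])
      fix x w assume x: "x \<in> set (refl_codes m)" "map mat_of (cube_block x) @ w \<in> hurwitz_orbit G6 T"
      show ?thesis
      proof (rule extract_cube[OF T' 3(1)])
        fix x' w' assume x': "x' \<in> set (refl_codes m)" "map mat_of (cube_block x') @ w' \<in> hurwitz_orbit G6 T'"
        show ?thesis
        proof (rule cancel[OF good_cube_block[OF 3(1)] _ less.prems(5) _ x x'])
          fix v v' assume "length v < length T" "set v \<subseteq> refl_mats" "set v' \<subseteq> refl_mats"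
            "list_mult G6 v = list_mult G6 v'" "\<And>l. num v l = num v' l" "coxeter_type v"
          then show "v' \<in> hurwitz_orbit G6 v"
            by (rule less.hyps)
        qed (use 3(1) in \<open>cases m; simp\<close>)
      qed (use 3 pos num in auto)
    qed
  next
    case (4 m)
    define ls where "ls = (if num T m = 1 then [Z0, m] else [Z0, m, m])"
    have count: "num T l = count (mset ls) l" for l
      using 4 by (cases "l = Z0 \<or> l = m") (auto simp: ls_def)
    have len: "length T = length ls"
      using length_eq_num[OF T] 4(1) unfolding count by (cases m) (auto simp: ls_def)
    show ?thesis
    proof (rule base_case[OF T T' less.prems(3) num 4(1) len])
      show "ls = [Z0, m] \<or> ls = [Z0, m, m]"
        by (simp add: ls_def)
    qed (rule count)
  qed
qed

theorem theorem1:
  fixes c :: "complex^2^2" and n :: nat and T T' :: "(complex^2^2) list"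
  assumes "is_coxeter_element G6 c"
    and "n > 0"
    and "is_reflection_factorization G6 c T" and "length T = n"
    and "is_reflection_factorization G6 c T'" and "length T' = n"
  shows "T' \<in> hurwitz_orbit G6 T \<longleftrightarrow>
    image_mset (conjugacy_class G6) (mset T) = image_mset (conjugacy_class G6) (mset T')"
proof
  have T: "set T \<subseteq> refl_mats" "set T' \<subseteq> refl_mats" and prod: "list_mult G6 T = list_mult G6 T'"
    using assms(3,5) reflections_G6 by (auto simp: is_reflection_factorization_def)
  have carrier: "set T \<subseteq> carrier G6" "set T' \<subseteq> carrier G6"
    using T refl_mats_carrier by auto
  show "image_mset (conjugacy_class G6) (mset T) = image_mset (conjugacy_class G6) (mset T')"
    if "T' \<in> hurwitz_orbit G6 T"
    using G6.hurwitz_orbit_image_mset[OF that carrier(1) G6.conjugacy_class_conj_by] by simp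
  assume "image_mset (conjugacy_class G6) (mset T) = image_mset (conjugacy_class G6) (mset T')"
  \<comment> \<open>From here on only the determinants of the entries matter; three values of
    \<open>det\<close> stand for three classes.\<close>
  then have "image_mset det (mset T) = image_mset det (mset T')"
    using G6.image_mset_eq_of_conjugacy_class[OF carrier, of det] det_conj_by by blast
  then have num: "num T l = num T' l" for l
    by (simp add: num_def)
  show "T' \<in> hurwitz_orbit G6 T"
    using coxeter_type_of_factorization[OF assms(1,3)] by (rule hurwitz_transitive[OF T prod num])
qed

end
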